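(* Let $n\ge 1$, let $f:\mathbb{R}^n\to\mathbb{R}$ be a smooth convex function and let $M\subset\mathbb{E}^{n+1}$ be its graph $\{(x,f(x)) : x\in\mathbb{R}^n\}$. For $p=(x,f(x))\in M$ put $W(p)=\sqrt{1+|\nabla f(x)|^2}$, where $\nabla f$ is the gradient of $f$. For a real number $k>0$, let $\Psi$ be the tangent hyperplane of $M$ at $p$ and let $\Phi$ be the hyperplane through the point $(x,f(x)+k)$ parallel to $\Psi$. Let $A_p^*(k)$ denote the $n$-dimensional area of the region in $\Phi$ enclosed by $\Phi\cap M$, and $V_p^*(k)$ the $(n+1)$-dimensional volume of the region bounded by $M$ and $\Phi$. Then $M$ is an elliptic paraboloid if and only if it satisfies one of the following conditions: $(V^* )$: there is a nonnegative function $\phi$ of $k$ alone such that $V_p^*(k)=\phi(k)$ for all $p\in M$ and all $k>0$; $(A^* )$: there is a nonnegative function $\psi$ of $k$ alone such that $A_p^*(k)/W(p)=\psi(k)$ for all $p\in M$ and all $k>0$.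
   Context: An elliptic paraboloid is a hypersurface congruent (by a rigid motion of $\mathbb{E}^{n+1}$) to $z=\sum_{i=1}^n a_i^2x_i^2$ with all $a_i>0$. *)

theory Defs
  imports "HOL-Analysis.Analysis"
begin

text \<open>Euclidean space E^{n+1} is modelled as (real^'n) \<times> real; a point (x,t) has
  horizontal part x and height t.\<close>

definition smooth_fun :: "(real^'n \<Rightarrow> real) \<Rightarrow> bool" where
  "smooth_fun f \<longleftrightarrow>
     (\<exists>F. f \<in> F \<and> (\<forall>g\<in>F. g differentiable_on UNIV \<and>
          (\<forall>i. (\<lambda>x. frechet_derivative g (at x) (axis i 1)) \<in> F)))"

definition gradient :: "(real^'n \<Rightarrow> real) \<Rightarrow> real^'n \<Rightarrow> real^'n" where
  "gradient f x = (\<chi> i. frechet_derivative f (at x) (axis i 1))"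

definition graph_of :: "(real^'n \<Rightarrow> real) \<Rightarrow> ((real^'n) \<times> real) set" where
  "graph_of f = {(x, f x) | x. True}"

definition W_fun :: "(real^'n \<Rightarrow> real) \<Rightarrow> real^'n \<Rightarrow> real" where
  "W_fun f x = sqrt (1 + (norm (gradient f x))\<^sup>2)"

definition rigid_motion :: "('a::metric_space \<Rightarrow> 'a) \<Rightarrow> bool" where
  "rigid_motion T \<longleftrightarrow> surj T \<and> (\<forall>u v. dist (T u) (T v) = dist u v)"

definition elliptic_paraboloid :: "((real^'n) \<times> real) set \<Rightarrow> bool" where
  "elliptic_paraboloid M \<longleftrightarrow>
     (\<exists>T a. rigid_motion T \<and> (\<forall>i. a $ i > 0) \<and>
        M = T ` {(x, \<Sum>i\<in>UNIV. (a $ i)\<^sup>2 * (x $ i)\<^sup>2) | x. True})"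

definition tangent_hyperplane :: "(real^'n \<Rightarrow> real) \<Rightarrow> real^'n \<Rightarrow> ((real^'n) \<times> real) set" where
  "tangent_hyperplane f x =
     {(y, t) | y t. t = f x + frechet_derivative f (at x) (y - x)}"

definition shifted_hyperplane :: "(real^'n \<Rightarrow> real) \<Rightarrow> real^'n \<Rightarrow> real \<Rightarrow> ((real^'n) \<times> real) set" where
  "shifted_hyperplane f x k = (\<lambda>z. z + (0, k)) ` tangent_hyperplane f x"

text \<open>n-dimensional area of a subset S of an n-dimensional affine subspace H of
  E^{n+1}: Lebesgue measure of the pullback of S under an isometric
  parametrisation of H by R^n (independent of the choice of parametrisation).\<close>
definition hyperplane_area :: "((real^'n) \<times> real) set \<Rightarrow> ((real^'n) \<times> real) set \<Rightarrow> ennreal" where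
  "hyperplane_area H S =
     (let T = (SOME T :: real^'n \<Rightarrow> (real^'n) \<times> real.
                 range T = H \<and> (\<forall>u v. dist (T u) (T v) = dist u v))
      in emeasure lebesgue {u. T u \<in> S})"

text \<open>Region of the hyperplane Phi enclosed by Phi \<inter> M (the part of Phi on or above M).\<close>
definition A_region :: "(real^'n \<Rightarrow> real) \<Rightarrow> real^'n \<Rightarrow> real \<Rightarrow> ((real^'n) \<times> real) set" where
  "A_region f x k = {(y, t) \<in> shifted_hyperplane f x k. f y \<le> t}"

definition A_star :: "(real^'n \<Rightarrow> real) \<Rightarrow> real^'n \<Rightarrow> real \<Rightarrow> ennreal" where
  "A_star f x k = hyperplane_area (shifted_hyperplane f x k) (A_region f x k)"

definition V_region :: "(real^'n \<Rightarrow> real) \<Rightarrow> real^'n \<Rightarrow> real \<Rightarrow> ((real^'n) \<times> real) set" where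
  "V_region f x k = {(y, t) | y t. f y \<le> t \<and>
       t \<le> f x + k + frechet_derivative f (at x) (y - x)}"

definition V_star :: "(real^'n \<Rightarrow> real) \<Rightarrow> real^'n \<Rightarrow> real \<Rightarrow> ennreal" where
  "V_star f x k = emeasure lebesgue (V_region f x k)"

end

(*
  Write D x y or D(x, y) for the Bregman divergence of f, i.e. the height of the graph at y above
  the tangent hyperplane at x. The cap volume is the integral of the positive part of k - D x, and
  the cap area divided by W is the measure of the sublevel set {D x <= k}. Integrating over k shows
  that the area condition implies the volume condition, and that under the latter the integral of
  (k - D x)_+^2 / 2 does not depend on x either.

  Comparing this integral at x and x', where D x - D x' is affine, to first order shows that x is
  the centroid of the weight (k - D x)_+. To second order it expresses phi(k) D(x', x) as the
  integral of (D x - D x')^2 / 2 over the sublevel set, up to an error at its boundary. Convexity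
  then forces |D x - D x'| = O(sqrt k) on the sublevel set, so the error is o(phi(k)) and, as the
  main term is symmetric in x and x', letting k tend to infinity gives D(x, x') = D(x', x).
  A symmetric Bregman divergence has an affine gradient, hence f is a quadratic polynomial.
*)
theory Submission
  imports Defs
begin

section \<open>Lebesgue measure\<close>

text \<open>The volume condition is integrated once more before base points are compared, because
  \<open>max 0 a\<close> has a kink at 0: its second variation would be an integral over the
  boundary of a sublevel set. The function \<open>(max 0 a)\<^sup>2 / 2\<close> has a Lipschitz
  derivative, so its Taylor remainder is controlled pointwise and all integrals stay over solid
  sets. The price is that the remainder is asymmetric where its two arguments have different signs,
  that is over the difference of \<open>S x K\<close> and \<open>S x' K\<close>. At a fixed K this
  defect need not vanish; it is O(phi / sqrt K) against a main term phi times a fixed number, whence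
  the limit.

  Base points are varied through their gradients, since \<open>g x' - g x\<close> is the slope of
  \<open>D x - D x'\<close>; that all gradients near \<open>g x\<close> occur is obtained by
  minimising a tilted divergence.

  In the converse the obstacle is that the rigid motion in \<open>elliptic_paraboloid\<close> is
  arbitrary. It has to be shown that it neither tilts nor flips the axis when the image is the graph
  of a convex function; after that, equal caps are translates of each other in the horizontal
  variable.\<close>

lemma nn_integral_lborel_translate:
  fixes f :: "'a::euclidean_space \<Rightarrow> ennreal"
  assumes [measurable]: "f \<in> borel_measurable borel"
  shows "(\<integral>\<^sup>+x. f (c + x) \<partial>lborel) = (\<integral>\<^sup>+x. f x \<partial>lborel)"
proof -
  have "(\<integral>\<^sup>+x. f x \<partial>lborel) = (\<integral>\<^sup>+x. f x \<partial>distr lborel borel ((+) c))"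
    by (simp add: lborel_distr_plus)
  also have "\<dots> = (\<integral>\<^sup>+x. f (c + x) \<partial>lborel)"
    by (subst nn_integral_distr) auto
  finally show ?thesis by simp
qed

lemma emeasure_lborel_ball_pos_finite:
  fixes c :: "'a::euclidean_space"
  assumes "0 < r"
  shows "emeasure lborel (ball c r) \<noteq> 0" "emeasure lborel (ball c r) \<noteq> \<infinity>"
proof -
  show "emeasure lborel (ball c r) \<noteq> 0"
    using assms open_not_negligible [of "ball c r"] by (auto simp: negligible_iff_null_sets null_sets_def emeasure_completion)
  show "emeasure lborel (ball c r) \<noteq> \<infinity>"
    using emeasure_lborel_ball_finite [of c r] by auto
qed

text \<open>The uniqueness argument for Haar measure: both sides agree on the unit ball, and the
  double integral of \<open>1\<^sub>A (T x + y) 1\<^sub>B y\<close> transfers this to every Borel set.\<close>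
lemma lborel_distr_orthogonal:
  fixes T :: "'a::euclidean_space \<Rightarrow> 'a"
  assumes T: "orthogonal_transformation T"
  shows "distr lborel borel T = lborel"
proof (rule measure_eqI)
  show "sets (distr lborel borel T) = sets (lborel :: 'a measure)" by simp
  fix A assume "A \<in> sets (distr lborel borel T)"
  then have [measurable]: "A \<in> sets borel" by simp
  have lin: "linear T" using T by (rule orthogonal_transformation_linear)
  have [measurable]: "T \<in> borel_measurable borel"
    using lin by (intro borel_measurable_continuous_onI linear_continuous_on)
      (simp add: linear_conv_bounded_linear)
  obtain S where S: "\<And>x. T (S x) = x" "orthogonal_transformation S"
    using orthogonal_transformation_inv [OF T] surj_f_inv_f [OF orthogonal_transformation_surj [OF T]]
    by blast
  have [measurable]: "S \<in> borel_measurable borel"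
    using orthogonal_transformation_linear [OF S(2)] by (intro borel_measurable_continuous_onI linear_continuous_on)
      (simp add: linear_conv_bounded_linear)
  define B where "B = ball (0::'a) 1"
  have [measurable]: "B \<in> sets borel" by (simp add: B_def)
  \<comment> \<open>Isometry enters here: the set of \<open>x\<close> with \<open>y - T x\<close> in
    \<open>B\<close> is the unit ball about \<open>S y\<close>, so its measure does not depend on
    \<open>y\<close>.\<close>
  have ball: "(\<integral>\<^sup>+x. indicator B (y - T x) \<partial>lborel) = emeasure lborel B" for y
  proof -
    have "y - T x = - T (x - S y)" for x
      by (simp add: linear_diff [OF lin] S(1))
    then have "norm (y - T x) = norm (x - S y)" for x
      by (simp add: orthogonal_transformation_norm [OF T])
    then have "(\<integral>\<^sup>+x. indicator B (y - T x) \<partial>lborel) = (\<integral>\<^sup>+x. indicator B (- S y + x) \<partial>lborel)"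
      by (intro nn_integral_cong) (auto simp: B_def indicator_def)
    also have "\<dots> = (\<integral>\<^sup>+x. indicator B x \<partial>lborel)"
      by (rule nn_integral_lborel_translate) measurable
    finally show ?thesis by simp
  qed
  have "emeasure lborel (T -` A) * emeasure lborel B
      = (\<integral>\<^sup>+y. (\<integral>\<^sup>+x. indicator A (T x) \<partial>lborel) * indicator B y \<partial>lborel)"
  proof -
    have "(\<lambda>x. indicator A (T x) :: ennreal) = indicator (T -` A)"
      by (auto simp: indicator_def)
    moreover have "T -` A \<in> sets borel"
      using measurable_sets_borel [of T borel A] by simp
    ultimately show ?thesis by (simp add: nn_integral_cmult)
  qed
  also have "\<dots> = (\<integral>\<^sup>+y. (\<integral>\<^sup>+x. indicator A (T x) * indicator B y \<partial>lborel) \<partial>lborel)"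
    by (intro nn_integral_cong) (simp add: nn_integral_multc)
  also have "\<dots> = (\<integral>\<^sup>+y. (\<integral>\<^sup>+x. indicator A (y + T x) * indicator B y \<partial>lborel) \<partial>lborel)"
  proof (rule nn_integral_cong)
    fix y
    have "(\<integral>\<^sup>+x. indicator A (T x) * indicator B y \<partial>lborel)
        = (\<integral>\<^sup>+x. indicator A (T (S y + x)) * indicator B y \<partial>lborel)"
      by (rule nn_integral_lborel_translate [symmetric]) measurable
    then show "(\<integral>\<^sup>+x. indicator A (T x) * indicator B y \<partial>lborel)
        = (\<integral>\<^sup>+x. indicator A (y + T x) * indicator B y \<partial>lborel)"
      by (simp add: linear_add [OF lin] S)
  qed
  also have "\<dots> = (\<integral>\<^sup>+x. (\<integral>\<^sup>+y. indicator A (y + T x) * indicator B y \<partial>lborel) \<partial>lborel)"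
    by (intro lborel_pair.Fubini') measurable
  also have "\<dots> = (\<integral>\<^sup>+x. (\<integral>\<^sup>+y. indicator A y * indicator B (y - T x) \<partial>lborel) \<partial>lborel)"
  proof (rule nn_integral_cong)
    fix x
    have "(\<integral>\<^sup>+y. indicator A y * indicator B (y - T x) \<partial>lborel)
        = (\<integral>\<^sup>+y. indicator A (T x + y) * indicator B (T x + y - T x) \<partial>lborel)"
      by (rule nn_integral_lborel_translate [symmetric]) measurable
    then show "(\<integral>\<^sup>+y. indicator A (y + T x) * indicator B y \<partial>lborel)
        = (\<integral>\<^sup>+y. indicator A y * indicator B (y - T x) \<partial>lborel)"
      by (simp add: add.commute)
  qed
  also have "\<dots> = (\<integral>\<^sup>+y. (\<integral>\<^sup>+x. indicator A y * indicator B (y - T x) \<partial>lborel) \<partial>lborel)"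
    by (intro lborel_pair.Fubini' [symmetric]) measurable
  also have "\<dots> = (\<integral>\<^sup>+y. indicator A y * emeasure lborel B \<partial>lborel)"
    by (intro nn_integral_cong) (simp add: nn_integral_cmult ball)
  also have "\<dots> = emeasure lborel A * emeasure lborel B"
    by (simp add: nn_integral_multc)
  finally have "emeasure lborel (T -` A) * emeasure lborel B = emeasure lborel A * emeasure lborel B" .
  then have "emeasure lborel (T -` A) = emeasure lborel A"
    using emeasure_lborel_ball_pos_finite [of 1 "0::'a"]
    by (simp add: B_def mult.commute [of _ "emeasure lborel (ball 0 1)"] ennreal_mult_cancel_left)
  then show "emeasure (distr lborel borel T) A = emeasure lborel A"
    by (simp add: emeasure_distr)
qed

lemma emeasure_lborel_vimage_orthogonal:
  fixes T :: "'a::euclidean_space \<Rightarrow> 'a"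
  assumes T: "orthogonal_transformation T" and A: "A \<in> sets borel"
  shows "emeasure lborel {x. T x \<in> A} = emeasure lborel A"
proof -
  have "T \<in> borel_measurable borel"
    using orthogonal_transformation_linear [OF T] by (intro borel_measurable_continuous_onI linear_continuous_on)
      (simp add: linear_conv_bounded_linear)
  then have "emeasure (distr lborel borel T) A = emeasure lborel {x. T x \<in> A}"
    using A by (simp add: emeasure_distr vimage_def)
  then show ?thesis by (simp add: lborel_distr_orthogonal [OF T])
qed

text \<open>A convex set containing a ball of radius \<open>2 * r\<close> and a far away point contains many disjoint
  balls of radius \<open>r\<close>, centred on the segment joining them.\<close>
lemma bounded_convex_finite_measure:
  fixes S :: "'a::euclidean_space set"
  assumes S: "convex S" "S \<in> sets borel" and int: "x \<in> interior S"
    and fin: "emeasure lborel S < \<infinity>"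
  shows "bounded S"
proof (rule ccontr)
  assume unb: "\<not> bounded S"
  obtain r0 where r0: "0 < r0" "ball x r0 \<subseteq> S"
    using int by (meson mem_interior)
  define r where "r = r0 / 2"
  have r: "0 < r" "ball x (2 * r) \<subseteq> S" using r0 by (auto simp: r_def)
  define b where "b = emeasure lborel (ball (0::'a) r)"
  have ballb: "emeasure lborel (ball c r) = b" for c :: 'a
    by (subst lborel_distr_plus [of c, symmetric], subst emeasure_distr)
       (auto simp: b_def intro!: arg_cong2 [where f=emeasure] simp: dist_norm)
  have b: "b \<noteq> 0" "b \<noteq> \<infinity>"
    using emeasure_lborel_ball_pos_finite [OF r(1), of "0::'a"] by (auto simp: b_def)
  have le: "of_nat N * b \<le> emeasure lborel S" for N
  proof -
    obtain y where y: "y \<in> S" "norm (y - x) > 4 * r * (real N + 1)"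
      using unb unfolding bounded_any_center [of _ x] by (auto simp: dist_norm norm_minus_commute not_le)
    \<comment> \<open>The parameters stay below 1/2, so that the homothety towards \<open>y\<close>
      shrinks the ball of radius 2r to one of radius at least r. The distance of \<open>y\<close>
      makes consecutive centres at least 2r apart.\<close>
    define c where "c i = x + (real i / (2 * (real N + 1))) *\<^sub>R (y - x)" for i
    have sub: "ball (c i) r \<subseteq> S" if "i < N" for i
    proof
      fix z assume z: "z \<in> ball (c i) r"
      define t where "t = real i / (2 * (real N + 1))"
      have t: "0 \<le> t" "t \<le> 1/2" using that by (auto simp: t_def field_simps)
      define w where "w = x + (1 / (1 - t)) *\<^sub>R (z - c i)"
      have "norm (z - c i) < r" using z by (simp add: dist_norm norm_minus_commute)
      moreover have t': "1 / (1 - t) \<le> 2" "0 < 1 / (1 - t)" using t by (auto simp: field_simps)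
      moreover have "(1 / (1 - t)) * norm (z - c i) \<le> 2 * norm (z - c i)"
        by (rule mult_right_mono [OF t'(1)]) simp
      ultimately have "norm ((1 / (1 - t)) *\<^sub>R (z - c i)) < 2 * r"
        by (simp only: norm_scaleR abs_of_pos)
      then have "w \<in> ball x (2 * r)" by (simp add: w_def dist_norm)
      then have "w \<in> S" using r by blast
      then have "(1 - t) *\<^sub>R w + t *\<^sub>R y \<in> S"
        using S y t by (intro convexD) auto
      moreover have "(1 - t) *\<^sub>R w + t *\<^sub>R y = z"
      proof -
        have "c i = x + t *\<^sub>R (y - x)" by (simp add: c_def t_def)
        moreover have "(1 - t) *\<^sub>R w = (1 - t) *\<^sub>R x + (z - c i)"
          using t by (simp add: w_def scaleR_add_right)
        ultimately show ?thesis by (simp add: algebra_simps)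
      qed
      ultimately show "z \<in> S" by simp
    qed
    have disj: "disjoint_family_on (\<lambda>i. ball (c i) r) {..<N}"
      unfolding disjoint_family_on_def
    proof (intro ballI impI)
      fix i j assume ij: "i \<in> {..<N}" "j \<in> {..<N}" "i \<noteq> j"
      have "c i - c j = ((real i - real j) / (2 * (real N + 1))) *\<^sub>R (y - x)"
        by (simp add: c_def algebra_simps diff_divide_distrib)
      then have dc: "dist (c i) (c j) = \<bar>real i - real j\<bar> / (2 * (real N + 1)) * norm (y - x)"
        by (simp add: dist_norm)
      have "1 \<le> \<bar>real i - real j\<bar>" using ij by linarith
      then have "1 / (2 * (real N + 1)) \<le> \<bar>real i - real j\<bar> / (2 * (real N + 1))"
        by (intro divide_right_mono) auto
      then have "1 / (2 * (real N + 1)) * norm (y - x) \<le> dist (c i) (c j)"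
        unfolding dc by (rule mult_right_mono) simp
      moreover have "2 * r \<le> 1 / (2 * (real N + 1)) * norm (y - x)"
        using y(2) by (simp add: pos_le_divide_eq algebra_simps)
      ultimately have "2 * r \<le> dist (c i) (c j)" by linarith
      then show "ball (c i) r \<inter> ball (c j) r = {}"
        by (intro disjoint_ballI) simp
    qed
    have "of_nat N * b = (\<Sum>i<N. emeasure lborel (ball (c i) r))" by (simp add: ballb)
    also have "\<dots> = emeasure lborel (\<Union>i<N. ball (c i) r)"
      using disj by (intro sum_emeasure) auto
    also have "\<dots> \<le> emeasure lborel S"
      using sub S by (intro emeasure_mono) auto
    finally show ?thesis .
  qed
  obtain m where m: "emeasure lborel S = ennreal m" "0 \<le> m"
    using fin by (cases "emeasure lborel S") auto
  obtain b' where b': "b = ennreal b'" "0 < b'"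
    using b by (cases b) (auto simp: less_le)
  obtain N where "m / b' < real N" using reals_Archimedean2 by blast
  then have "m < real N * b'" using b' by (simp add: field_simps)
  moreover have "real N * b' \<le> m"
    using le [of N] m b' by (simp add: ennreal_of_nat_eq_real_of_nat flip: ennreal_mult)
  ultimately show False by simp
qed

section \<open>Bregman divergences and their sublevel sets\<close>

lemma integrable_lborel_compact_support:
  fixes h :: "'a::euclidean_space \<Rightarrow> real"
  assumes "compact C" "continuous_on UNIV h" "\<And>y. y \<notin> C \<Longrightarrow> h y = 0"
  shows "integrable lborel h"
proof -
  have "integrable lborel (\<lambda>y. indicator C y *\<^sub>R h y)"
    using assms by (intro borel_integrable_compact) (auto intro: continuous_on_subset)
  also have "(\<lambda>y. indicator C y *\<^sub>R h y) = h"
    using assms(3) by (auto simp: fun_eq_iff indicator_def)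
  finally show ?thesis .
qed

lemma measure_lborel_affine_image:
  fixes A :: "'a::euclidean_space set"
  assumes "compact A"
  shows "measure lborel ((\<lambda>y. t *\<^sub>R y + d) ` A) = \<bar>t\<bar> ^ DIM('a) * measure lborel A"
proof -
  have "compact ((\<lambda>y. t *\<^sub>R y + d) ` A)"
    using assms by (intro compact_continuous_image continuous_intros)
  then show ?thesis
    using assms measure_lebesgue_affine [of t d A]
    by (simp add: measure_completion borel_compact)
qed

text \<open>The first-order Taylor remainder of \<open>a \<mapsto> (max 0 a)\<^sup>2 / 2\<close>; it is symmetric in \<open>a\<close> and \<open>b\<close> unless
  the signs differ.\<close>
definition trunc_sq_rem :: "real \<Rightarrow> real \<Rightarrow> real" where
  "trunc_sq_rem a b = (max 0 b)\<^sup>2 / 2 - (max 0 a)\<^sup>2 / 2 - max 0 a * (b - a)"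

lemma trunc_sq_rem_cases:
  "trunc_sq_rem a b =
     (if 0 \<le> a then if 0 \<le> b then (b - a)\<^sup>2 / 2 else a * (a - b) - a\<^sup>2 / 2
      else if 0 \<le> b then b\<^sup>2 / 2 else 0)"
  by (auto simp: trunc_sq_rem_def max_def power2_eq_square field_simps)

lemma trunc_sq_rem_nonneg: "0 \<le> trunc_sq_rem a b"
proof -
  have "a\<^sup>2 / 2 \<le> a * (a - b)" if "0 \<le> a" "b < 0"
    using that mult_nonneg_nonneg [of a "a - 2 * b"] by (simp add: power2_eq_square algebra_simps)
  then show ?thesis by (auto simp: trunc_sq_rem_cases)
qed

lemma trunc_sq_rem_le: "trunc_sq_rem a b \<le> (b - a)\<^sup>2 / 2"
proof -
  have 1: "a * (a - b) - a\<^sup>2 / 2 \<le> (b - a)\<^sup>2 / 2"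
    by (simp add: power2_eq_square field_simps)
  have "b\<^sup>2 / 2 \<le> (b - a)\<^sup>2 / 2" if "\<not> 0 \<le> a" "0 \<le> b"
    using that power_mono [of b "b - a" 2] by simp
  then show ?thesis using 1 by (auto simp: trunc_sq_rem_cases)
qed

text \<open>The minimum reflects the sign of \<open>b\<close>. While \<open>b\<close> is nonnegative
  the remainder is exactly quadratic in the increment; once \<open>b\<close> is negative the
  truncation flattens it to linear growth, and it is still at least
  \<open>a * (a - b) / 2\<close>.\<close>

lemma trunc_sq_rem_ge:
  assumes "0 < K" "K / 2 \<le> a" "0 \<le> r" "r \<le> \<bar>b - a\<bar>"
  shows "min (r\<^sup>2 / 2) (K * r / 4) \<le> trunc_sq_rem a b"
proof (cases "0 \<le> b")
  case True
  have "r\<^sup>2 \<le> (b - a)\<^sup>2"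
    using assms by (metis abs_le_square_iff abs_of_nonneg)
  then show ?thesis using True assms by (simp add: trunc_sq_rem_cases)
next
  case False
  have "K * r / 4 = (K / 2) * r / 2" by simp
  also have "\<dots> \<le> a * (a - b) / 2"
    using assms False by (intro divide_right_mono mult_mono) auto
  also have "\<dots> \<le> a * (a - b) - a\<^sup>2 / 2"
    using assms False mult_nonneg_nonneg [of a "- b"] by (simp add: power2_eq_square field_simps)
  finally show ?thesis using False assms by (simp add: trunc_sq_rem_cases)
qed

text \<open>For opposite signs the two remainders differ by the product of the absolute values of
  \<open>a\<close> and \<open>b\<close>, and these add up to the absolute value of
  \<open>b - a\<close>; the bound is the inequality of arithmetic and geometric means.\<close>

lemma trunc_sq_rem_diff:
  "\<bar>trunc_sq_rem a b - trunc_sq_rem b a\<bar> \<le> (if 0 \<le> a \<longleftrightarrow> 0 \<le> b then 0 else (b - a)\<^sup>2 / 4)"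
proof -
  have 1: "\<bar>a * (a - b) - a\<^sup>2 / 2 - a\<^sup>2 / 2\<bar> \<le> (b - a)\<^sup>2 / 4" if "0 \<le> a" "b < 0" for a b :: real
  proof -
    have "a * (a - b) - a\<^sup>2 / 2 - a\<^sup>2 / 2 = a * (- b)"
      by (simp add: power2_eq_square algebra_simps)
    moreover have "0 \<le> a * (- b)" using that by (intro mult_nonneg_nonneg) auto
    moreover have "0 \<le> (a + b)\<^sup>2" by simp
    ultimately show ?thesis by (simp add: power2_eq_square algebra_simps)
  qed
  show ?thesis
    using 1 [of a b] 1 [of b a]
    by (auto simp: trunc_sq_rem_cases power2_commute abs_minus_commute)
qed

locale convex_potential =
  fixes f :: "'a::euclidean_space \<Rightarrow> real" and g :: "'a \<Rightarrow> 'a"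
  assumes convex_f: "convex_on UNIV f"
    and deriv_f: "\<And>x. (f has_derivative (\<lambda>h. g x \<bullet> h)) (at x)"
begin

text \<open>The Bregman divergence: height of the graph at \<open>y\<close> above the tangent hyperplane at \<open>x\<close>.\<close>
definition D :: "'a \<Rightarrow> 'a \<Rightarrow> real" where "D x y = f y - f x - g x \<bullet> (y - x)"

text \<open>The vertical projection of the cap of height \<open>k\<close> at \<open>x\<close>, and
  equally of its flat face.\<close>

definition S :: "'a \<Rightarrow> real \<Rightarrow> 'a set" where "S x k = {y. D x y \<le> k}"

text \<open>The length of the vertical chord over \<open>y\<close> of the cap of height
  \<open>K\<close> at \<open>x\<close>, so that its integral is the cap volume.\<close>

definition P :: "'a \<Rightarrow> real \<Rightarrow> 'a \<Rightarrow> real" where "P x K y = max 0 (K - D x y)"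

lemma D_self [simp]: "D x x = 0" by (simp add: D_def)

lemma continuous_f: "continuous_on A f"
  by (meson continuous_at_imp_continuous_on deriv_f has_derivative_continuous)

lemma continuous_D [continuous_intros]: "continuous_on A (D x)"
  unfolding D_def by (intro continuous_intros continuous_f)

lemma continuous_P [continuous_intros]: "continuous_on A (P x K)"
  unfolding P_def by (intro continuous_intros)

lemma measurable_D [measurable]: "D x \<in> borel_measurable borel"
  by (intro borel_measurable_continuous_onI continuous_D)

lemma measurable_P [measurable]: "P x K \<in> borel_measurable borel"
  by (intro borel_measurable_continuous_onI continuous_P)

lemma closed_S: "closed (S x k)"
  unfolding S_def by (intro closed_Collect_le continuous_intros)

lemma sets_S [measurable]: "S x k \<in> sets borel"
  using closed_S by (rule borel_closed)

lemma convex_D: "convex_on UNIV (D x)"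
proof (rule convex_onI)
  fix t :: real and y z assume t: "0 < t" "t < 1"
  have "f ((1 - t) *\<^sub>R y + t *\<^sub>R z) \<le> (1 - t) * f y + t * f z"
    using convex_onD [OF convex_f, of t y z] t by simp
  then show "D x ((1 - t) *\<^sub>R y + t *\<^sub>R z) \<le> (1 - t) * D x y + t * D x z"
    by (simp add: D_def inner_simps algebra_simps)
qed simp

lemma D_convexD: "0 \<le> t \<Longrightarrow> t \<le> 1 \<Longrightarrow> D x ((1 - t) *\<^sub>R y + t *\<^sub>R z) \<le> (1 - t) * D x y + t * D x z"
  using convex_onD [OF convex_D] by simp

lemma D_scale: "0 \<le> t \<Longrightarrow> t \<le> 1 \<Longrightarrow> D x ((1 - t) *\<^sub>R x + t *\<^sub>R y) \<le> t * D x y"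
  using D_convexD [of t x x y] by simp

lemma D_nonneg: "0 \<le> D x y"
proof -
  define h where "h t = f (x + t *\<^sub>R (y - x))" for t
  have "convex_on UNIV h"
  proof (rule convex_onI)
    fix t a b :: real assume t: "0 < t" "t < 1"
    have "x + ((1 - t) *\<^sub>R a + t *\<^sub>R b) *\<^sub>R (y - x)
        = (1 - t) *\<^sub>R (x + a *\<^sub>R (y - x)) + t *\<^sub>R (x + b *\<^sub>R (y - x))"
      by (simp add: algebra_simps)
    then show "h ((1 - t) *\<^sub>R a + t *\<^sub>R b) \<le> (1 - t) * h a + t * h b"
      using convex_onD [OF convex_f, of t "x + a *\<^sub>R (y - x)" "x + b *\<^sub>R (y - x)"] t
      by (simp add: h_def)
  qed simp
  moreover have "(h has_field_derivative g x \<bullet> (y - x)) (at 0)"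
  proof -
    have "(f has_derivative (\<lambda>h. g x \<bullet> h)) (at (x + 0 *\<^sub>R (y - x)))"
      using deriv_f by simp
    moreover have "((\<lambda>t. x + t *\<^sub>R (y - x)) has_derivative (\<lambda>t. t *\<^sub>R (y - x))) (at 0)"
      by (auto intro!: derivative_eq_intros)
    ultimately have "(h has_derivative (\<lambda>t. g x \<bullet> (t *\<^sub>R (y - x)))) (at 0)"
      unfolding h_def by (rule has_derivative_compose [rotated])
    then show ?thesis
      by (simp add: has_field_derivative_def mult_commute_abs)
  qed
  ultimately have "h 1 - h 0 \<ge> g x \<bullet> (y - x) * (1 - 0)"
    by (intro convex_on_imp_above_tangent [of UNIV]) auto
  then show ?thesis by (simp add: h_def D_def)
qed

text \<open>The source of every comparison between base points: the difference is affine in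
  \<open>y\<close>, and its value at \<open>y = x\<close> brings in \<open>D x' x\<close>, one side
  of the symmetry to be proved.\<close>

lemma D_diff: "D x y - D x' y = (g x' - g x) \<bullet> (y - x) - D x' x"
  by (simp add: D_def inner_simps)

lemma convex_S: "convex (S x k)"
proof (rule convexI)
  fix y z and u v :: real assume "y \<in> S x k" "z \<in> S x k" "0 \<le> u" "0 \<le> v" "u + v = 1"
  then have "D x ((1 - v) *\<^sub>R y + v *\<^sub>R z) \<le> (1 - v) * k + v * k" "u = 1 - v"
    by (auto intro!: order.trans [OF D_convexD] add_mono mult_left_mono simp: S_def)
  then show "u *\<^sub>R y + v *\<^sub>R z \<in> S x k" by (simp add: S_def flip: distrib_right)
qed

lemma S_mono: "k \<le> l \<Longrightarrow> S x k \<subseteq> S x l"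
  by (auto simp: S_def)

lemma center_interior_S:
  assumes "0 < k" shows "x \<in> interior (S x k)"
proof (rule interiorI)
  show "open {y. D x y < k}" by (intro open_Collect_less continuous_intros)
qed (use assms in \<open>auto simp: S_def\<close>)

lemma nn_integral_P: "(\<integral>\<^sup>+y. ennreal (K - D x y) \<partial>lborel) = (\<integral>\<^sup>+y. ennreal (P x K y) \<partial>lborel)"
  by (simp add: P_def ennreal_max_0 max.commute)

text \<open>Tonelli, since \<open>(max 0 a)\<^sup>2 / 2\<close> is a primitive of
  \<open>max 0 a\<close>. Heights \<open>u \<le> 0\<close> may stay in the range because the inner
  integral vanishes there by \<open>D_nonneg\<close>.\<close>

lemma layer_cake_square:
  "(\<integral>\<^sup>+y. ennreal ((P x K y)\<^sup>2 / 2) \<partial>lborel)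
    = (\<integral>\<^sup>+u. (\<integral>\<^sup>+y. ennreal (u - D x y) \<partial>lborel) * indicator {..K} u \<partial>lborel)"
proof -
  have *: "ennreal ((P x K y)\<^sup>2 / 2) = (\<integral>\<^sup>+u. ennreal (u - D x y) * indicator {..K} u \<partial>lborel)" for y
  proof -
    have "(\<integral>\<^sup>+u. ennreal (u - D x y) * indicator {..K} u \<partial>lborel)
        = (\<integral>\<^sup>+u. ennreal (u - D x y) * indicator {D x y..K} u \<partial>lborel)"
      by (intro nn_integral_cong) (auto simp: indicator_def ennreal_neg)
    also have "\<dots> = ennreal ((P x K y)\<^sup>2 / 2)"
    proof (cases "D x y \<le> K")
      case True
      then have "(\<integral>\<^sup>+u. ennreal (u - D x y) * indicator {D x y..K} u \<partial>lborel)
          = ennreal ((K - D x y)\<^sup>2 / 2 - (D x y - D x y)\<^sup>2 / 2)"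
        by (intro nn_integral_FTC_Icc) (auto intro!: derivative_eq_intros)
      then show ?thesis using True by (simp add: P_def)
    qed (simp add: P_def)
    finally show ?thesis by simp
  qed
  have "(\<integral>\<^sup>+y. ennreal ((P x K y)\<^sup>2 / 2) \<partial>lborel)
      = (\<integral>\<^sup>+y. (\<integral>\<^sup>+u. ennreal (u - D x y) * indicator {..K} u \<partial>lborel) \<partial>lborel)"
    by (simp add: *)
  also have "\<dots> = (\<integral>\<^sup>+u. (\<integral>\<^sup>+y. ennreal (u - D x y) * indicator {..K} u \<partial>lborel) \<partial>lborel)"
    by (intro lborel_pair.Fubini') measurable
  also have "\<dots> = (\<integral>\<^sup>+u. (\<integral>\<^sup>+y. ennreal (u - D x y) \<partial>lborel) * indicator {..K} u \<partial>lborel)"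
    by (intro nn_integral_cong) (simp add: nn_integral_multc)
  finally show ?thesis .
qed

text \<open>Height 0 is excluded because the area condition speaks of positive heights only; this
  removes a null set.\<close>

lemma layer_cake:
  "(\<integral>\<^sup>+y. ennreal (K - D x y) \<partial>lborel)
    = (\<integral>\<^sup>+u. emeasure lborel (S x u) * indicator {0<..K} u \<partial>lborel)"
proof -
  have *: "ennreal (K - D x y) = (\<integral>\<^sup>+u. indicator (S x u) y * indicator {0<..K} u \<partial>lborel)" for y
  proof -
    have "(\<integral>\<^sup>+u. indicator (S x u) y * indicator {0<..K} u \<partial>lborel)
        = (\<integral>\<^sup>+u. indicator ({D x y..K} - {0}) u \<partial>lborel)"
      using D_nonneg [of x y] by (intro nn_integral_cong) (auto simp: indicator_def S_def)
    also have "\<dots> = emeasure lborel ({D x y..K} - {0})" by simp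
    also have "\<dots> = emeasure lborel {D x y..K}"
      by (intro emeasure_Diff_null_set) auto
    also have "\<dots> = ennreal (K - D x y)"
      by (cases "D x y \<le> K") (auto simp: ennreal_neg)
    finally show ?thesis by simp
  qed
  \<comment> \<open>As an indicator on pairs, the integrand is visibly jointly measurable, which
    Fubini needs.\<close>
  have ind: "indicator (S x u) y = (indicator {p. D x (fst p) \<le> snd p} (y, u) :: ennreal)" for u y
    by (simp add: S_def indicator_def)
  have "(\<integral>\<^sup>+y. ennreal (K - D x y) \<partial>lborel)
      = (\<integral>\<^sup>+y. (\<integral>\<^sup>+u. indicator (S x u) y * indicator {0<..K} u \<partial>lborel) \<partial>lborel)"
    by (simp add: *)
  also have "\<dots> = (\<integral>\<^sup>+u. (\<integral>\<^sup>+y. indicator (S x u) y * indicator {0<..K} u \<partial>lborel) \<partial>lborel)"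
    unfolding ind by (intro lborel_pair.Fubini') measurable
  also have "\<dots> = (\<integral>\<^sup>+u. emeasure lborel (S x u) * indicator {0<..K} u \<partial>lborel)"
    by (intro nn_integral_cong) (simp add: nn_integral_multc)
  finally show ?thesis .
qed

end

section \<open>Constant cap volume\<close>

text \<open>\<open>cap_finite\<close> records that the prescribed volume is a real number.
  Compactness of the sublevel sets is drawn from it.\<close>

locale constant_cap_volume = convex_potential +
  assumes cap_const: "\<And>x x' K. 0 < K \<Longrightarrow>
      (\<integral>\<^sup>+y. ennreal (K - D x y) \<partial>lborel) = (\<integral>\<^sup>+y. ennreal (K - D x' y) \<partial>lborel)"
    and cap_finite: "\<And>x K. 0 < K \<Longrightarrow> (\<integral>\<^sup>+y. ennreal (K - D x y) \<partial>lborel) < \<infinity>"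
begin

text \<open>On \<open>S x l\<close> the cap of height \<open>2 * l\<close> has thickness at least
  \<open>l\<close>, so finite cap volume bounds the measure of \<open>S x l\<close>; a convex set
  with an interior point and finite measure is bounded. Taking \<open>l\<close> at least 1 makes the
  height positive.\<close>

lemma compact_S: "compact (S x k)"
proof -
  define l where "l = max k 1"
  have l: "0 < l" "S x k \<subseteq> S x l" using S_mono [of k "max k 1" x] by (auto simp: l_def)
  have "ennreal l * emeasure lborel (S x l) = (\<integral>\<^sup>+y. ennreal l * indicator (S x l) y \<partial>lborel)"
    by (simp add: nn_integral_cmult)
  also have "\<dots> \<le> (\<integral>\<^sup>+y. ennreal (2 * l - D x y) \<partial>lborel)"
    by (intro nn_integral_mono) (auto simp: indicator_def S_def intro!: ennreal_leI)
  also have "\<dots> < \<infinity>" using l by (intro cap_finite) auto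
  finally have "emeasure lborel (S x l) < \<infinity>"
    using l by (auto simp: ennreal_mult_less_top)
  then have "bounded (S x l)"
    by (intro bounded_convex_finite_measure [OF convex_S sets_S center_interior_S] l)
  then have "bounded (S x k)" using l(2) by (rule bounded_subset)
  then show ?thesis using closed_S by (simp add: compact_eq_bounded_closed)
qed

lemma integrable_P_mult:
  assumes "continuous_on UNIV h" shows "integrable lborel (\<lambda>y. P x K y * h y)"
  by (rule integrable_lborel_compact_support [OF compact_S [of x K]])
     (auto intro!: continuous_intros assms simp: P_def S_def)

lemma integrable_P: "integrable lborel (P x K)"
  using integrable_P_mult [of "\<lambda>_. 1"] by simp

lemma integrable_P_square: "integrable lborel (\<lambda>y. (P x K y)\<^sup>2 / 2)"
  using integrable_P_mult [of "\<lambda>y. P x K y / 2" x K]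
  by (simp add: power2_eq_square continuous_intros)

definition phi :: "'a \<Rightarrow> real \<Rightarrow> real" where "phi x K = (\<integral>y. P x K y \<partial>lborel)"

text \<open>The quotient of cap area by \<open>W\<close>. Under the volume condition alone it may a
  priori depend on \<open>x\<close>; what is available is that \<open>K * psi x K\<close> and
  \<open>phi x K\<close> are comparable.\<close>

definition psi :: "'a \<Rightarrow> real \<Rightarrow> real" where "psi x k = measure lborel (S x k)"

lemma phi_const: "0 < K \<Longrightarrow> phi x K = phi x' K"
  using cap_const [of K x x'] unfolding phi_def nn_integral_P
  by (simp add: integral_eq_nn_integral P_def)

lemma P_square_const:
  "(\<integral>y. (P x K y)\<^sup>2 / 2 \<partial>lborel) = (\<integral>y. (P x' K y)\<^sup>2 / 2 \<partial>lborel)"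
proof -
  have "(\<integral>\<^sup>+y. ennreal (u - D x y) \<partial>lborel) = (\<integral>\<^sup>+y. ennreal (u - D x' y) \<partial>lborel)" for u
  proof (cases "0 < u")
    case False
    then have "ennreal (u - D z y) = 0" for z y
      using D_nonneg [of z y] by (intro ennreal_neg) auto
    then show ?thesis by simp
  qed (rule cap_const)
  then have "(\<integral>\<^sup>+y. ennreal ((P x K y)\<^sup>2 / 2) \<partial>lborel) = (\<integral>\<^sup>+y. ennreal ((P x' K y)\<^sup>2 / 2) \<partial>lborel)"
    by (simp add: layer_cake_square)
  moreover have "(\<integral>y. (P z K y)\<^sup>2 / 2 \<partial>lborel) = enn2real (\<integral>\<^sup>+y. ennreal ((P z K y)\<^sup>2 / 2) \<partial>lborel)" for z
    by (rule integral_eq_nn_integral) auto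
  ultimately show ?thesis by simp
qed

lemma integrable_indicator_S [simp]: "integrable lborel (indicator (S x k) :: 'a \<Rightarrow> real)"
  using compact_S [of x k] fmeasurable_compact [of "S x k"]
  by (auto simp: fmeasurable_def integrable_indicator_iff)

section \<open>Scaling and growth of the sublevel sets\<close>

lemma psi_pos: "0 < k \<Longrightarrow> 0 < psi x k"
proof -
  assume k: "0 < k"
  then obtain r where r: "0 < r" "ball x r \<subseteq> S x k"
    using center_interior_S mem_interior by blast
  have "ball x r \<in> fmeasurable lborel"
    using emeasure_lborel_ball_finite [of x r] by (auto simp: fmeasurable_def)
  then have "measure lborel (ball x r) \<noteq> 0"
    using emeasure_lborel_ball_pos_finite [of r x] r(1)
    by (auto simp: measure_def enn2real_eq_0_iff)
  then have "0 < measure lborel (ball x r)" by (simp add: zero_less_measure_iff)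
  also have "\<dots> \<le> psi x k"
    unfolding psi_def using compact_S r by (intro measure_mono_fmeasurable fmeasurable_compact) auto
  finally show ?thesis .
qed

text \<open>Since \<open>D x\<close> is convex and vanishes at \<open>x\<close>, the homothety with
  centre \<open>x\<close> and ratio \<open>t\<close> maps \<open>S x k\<close> into
  \<open>S x (t * k)\<close>.\<close>

lemma psi_scale:
  assumes "0 \<le> t" "t \<le> 1" shows "t ^ DIM('a) * psi x k \<le> psi x (t * k)"
proof -
  let ?A = "(\<lambda>y. t *\<^sub>R y + (1 - t) *\<^sub>R x) ` S x k"
  have "t ^ DIM('a) * psi x k = measure lborel ?A"
    using assms compact_S by (simp add: psi_def measure_lborel_affine_image)
  also have "compact ?A"
    using compact_S by (intro compact_continuous_image continuous_intros)
  then have "measure lborel ?A \<le> psi x (t * k)"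
    unfolding psi_def
  proof (intro measure_mono_fmeasurable fmeasurable_compact compact_S)
    show "?A \<subseteq> S x (t * k)"
    proof clarify
      fix y assume "y \<in> S x k"
      then have "t * D x y \<le> t * k" using assms by (intro mult_left_mono) (simp add: S_def)
      then show "t *\<^sub>R y + (1 - t) *\<^sub>R x \<in> S x (t * k)"
        using D_scale [OF assms, of x y] by (simp add: S_def add.commute)
    qed
  qed (simp add: borel_compact)
  finally show ?thesis .
qed

lemma phi_upper: "0 < K \<Longrightarrow> phi x K \<le> K * psi x K"
proof -
  assume K: "0 < K"
  have "phi x K \<le> (\<integral>y. K * indicator (S x K) y \<partial>lborel)"
    unfolding phi_def using K D_nonneg
    by (intro integral_mono integrable_P integrable_mult_right integrable_indicator_S)
       (auto simp: P_def S_def indicator_def)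
  then show ?thesis by (simp add: psi_def)
qed

text \<open>The cap has thickness at least \<open>K / 2\<close> over \<open>S x (K / 2)\<close>. One
  factor 2 comes from this thickness, the others from \<open>psi_scale\<close> at 1/2.\<close>

lemma phi_lower: "0 < K \<Longrightarrow> K * psi x K \<le> 2 ^ (DIM('a) + 1) * phi x K"
proof -
  assume K: "0 < K"
  have "(\<integral>y. (K / 2) * indicator (S x (K / 2)) y \<partial>lborel) \<le> phi x K"
    unfolding phi_def using K D_nonneg
    by (intro integral_mono integrable_P integrable_mult_right integrable_indicator_S)
       (auto simp: P_def S_def indicator_def)
  then have "K / 2 * psi x (K / 2) \<le> phi x K" by (simp add: psi_def)
  moreover have "K * psi x K \<le> 2 ^ (DIM('a) + 1) * (K / 2 * psi x (K / 2))"
    using psi_scale [of "1/2" x K] K by (simp add: power_divide field_simps)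
  moreover have "2 ^ (DIM('a) + 1) * (K / 2 * psi x (K / 2)) \<le> 2 ^ (DIM('a) + 1) * phi x K"
    using calculation(1) by (intro mult_left_mono) auto
  ultimately show ?thesis by linarith
qed

lemma phi_pos: "0 < K \<Longrightarrow> 0 < phi x K"
proof -
  assume K: "0 < K"
  have "0 < 2 ^ (DIM('a) + 1) * phi x K"
    using phi_lower [OF K, of x] mult_pos_pos [OF K psi_pos [OF K, of x]] by linarith
  then show ?thesis by (simp add: zero_less_mult_iff)
qed

text \<open>The point at distance \<open>R\<close> from \<open>x\<close> on the segment towards
  \<open>y\<close> lies outside \<open>S x 1\<close>, so \<open>D x\<close> exceeds 1 there;
  convexity and \<open>D x x = 0\<close> carry this outwards along the ray.\<close>

lemma linear_growth:
  assumes R: "0 < R" "S x 1 \<subseteq> ball x R" and y: "R \<le> norm (y - x)"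
  shows "norm (y - x) / R < D x y"
proof -
  define t where "t = R / norm (y - x)"
  have n: "0 < norm (y - x)" using R y by linarith
  have t: "0 < t" "t \<le> 1" using R y n by (auto simp: t_def)
  have "(1 - t) *\<^sub>R x + t *\<^sub>R y - x = t *\<^sub>R (y - x)" by (simp add: algebra_simps)
  then have "norm ((1 - t) *\<^sub>R x + t *\<^sub>R y - x) = R"
    using n R by (simp add: t_def)
  then have "(1 - t) *\<^sub>R x + t *\<^sub>R y \<notin> S x 1"
    using R by (auto simp: dist_norm norm_minus_commute subset_iff)
  then have "1 < t * D x y"
    using D_scale [of t x y] t by (auto simp: S_def)
  then show ?thesis using n R by (simp add: t_def field_simps)
qed

text \<open>\<open>D x y - w \<bullet> (y - x)\<close> attains a minimum inside the ball.\<close>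
lemma gradient_perturb:
  assumes R: "0 < R" "S x 1 \<subseteq> ball x R" and w: "norm w * R < 1"
  obtains x' where "g x' = g x + w"
proof -
  define h where "h y = D x y - w \<bullet> (y - x)" for y
  have "continuous_on (cball x R) h" unfolding h_def by (intro continuous_intros)
  then obtain x' where x': "x' \<in> cball x R" "\<And>y. y \<in> cball x R \<Longrightarrow> h x' \<le> h y"
    using continuous_attains_inf [of "cball x R" h] R by auto
  have "h x' \<le> 0" using x'(2) [of x] R by (simp add: h_def)
  \<comment> \<open>On the sphere \<open>D x\<close> exceeds 1, hence exceeds the linear term,
    whereas \<open>h\<close> is 0 at the centre: the minimum cannot lie on the boundary.\<close>
  have "norm (x' - x) \<noteq> R"
  proof
    assume n: "norm (x' - x) = R"
    then have "1 < D x x'" using linear_growth [OF R, of x'] R by simp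
    moreover have "w \<bullet> (x' - x) \<le> norm w * R"
      using norm_cauchy_schwarz [of w "x' - x"] n by simp
    ultimately show False using \<open>h x' \<le> 0\<close> w by (simp add: h_def)
  qed
  then have "x' \<in> ball x R" using x'(1) by (auto simp: dist_norm norm_minus_commute)
  moreover have "(h has_derivative (\<lambda>v. g x' \<bullet> v - g x \<bullet> v - w \<bullet> v)) (at x')"
    unfolding h_def D_def by (auto intro!: derivative_eq_intros deriv_f)
  moreover have "\<forall>y\<in>ball x R. h x' \<le> h y" using x'(2) by auto
  ultimately have "(\<lambda>v. g x' \<bullet> v - g x \<bullet> v - w \<bullet> v) = (\<lambda>v. 0)"
    using differential_zero_maxmin [of x' "ball x R" h] by blast
  then have "(g x' - g x - w) \<bullet> (g x' - g x - w) = 0"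
    unfolding inner_diff_left by (rule fun_cong)
  then have "g x' - g x - w = 0" by (simp only: inner_eq_zero_iff)
  then have "g x' = g x + w" by (simp add: algebra_simps)
  then show ?thesis by (rule that)
qed

text \<open>Moving to a point with gradient \<open>g x + e *\<^sub>R w\<close> leaves the integral
  of the squared weight unchanged, yet raises it by at most \<open>e * ?c + e\<^sup>2 * C\<close>.
  Dividing by \<open>e\<close> and letting it tend to 0 gives the sign. Applied to \<open>w\<close>
  and \<open>- w\<close>, this makes \<open>x\<close> the centroid of the weight.\<close>

lemma moment_nonneg:
  assumes K: "0 < K" shows "0 \<le> (\<integral>y. P x K y * (w \<bullet> (y - x)) \<partial>lborel)" (is "0 \<le> ?c")
proof -
  obtain R where R: "0 < R" "S x 1 \<subseteq> ball x R"
    using compact_imp_bounded [OF compact_S] bounded_subset_ballD by blast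
  \<comment> \<open>\<open>R'\<close> and \<open>e0\<close> are matched: outside the ball of radius
    \<open>R'\<close> the growth of \<open>D x\<close> beats both \<open>K\<close> and the tilt, so
    both truncations vanish and the quadratic error lives on one compact set for all
    \<open>e \<le> e0\<close>. The factor 2 in \<open>e0\<close> keeps the tilt below half the
    growth rate; the added 1 covers \<open>w = 0\<close>.\<close>
  define R' where "R' = max R (2 * R * K)"
  define e0 where "e0 = 1 / (2 * R * (norm w + 1))"
  have e0: "0 < e0" using R by (auto simp: e0_def intro!: divide_pos_pos mult_pos_pos add_nonneg_pos)
  define C where "C = (\<integral>y. indicator (cball x R') y * ((w \<bullet> (y - x))\<^sup>2 / 2) \<partial>lborel)"
  have intC: "integrable lborel (\<lambda>y. indicator (cball x R') y * ((w \<bullet> (y - x))\<^sup>2 / 2))"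
  proof -
    have "continuous_on (cball x R') (\<lambda>y. (w \<bullet> (y - x))\<^sup>2 / 2)" by (intro continuous_intros) simp
    from borel_integrable_compact [OF compact_cball this] show ?thesis by simp
  qed
  have intM: "integrable lborel (\<lambda>y. P x K y * (w \<bullet> (y - x)))"
    by (intro integrable_P_mult continuous_intros)
  have main: "0 \<le> ?c + e * C" if e: "0 < e" "e \<le> e0" for e
  proof -
    have "e * (2 * R * (norm w + 1)) \<le> 1"
      using e R by (simp add: e0_def pos_le_divide_eq add_nonneg_pos)
    then have ew: "e * norm w * (2 * R) \<le> 1"
      using mult_pos_pos [OF e(1) R(1)] by (simp add: algebra_simps)
    then have "norm (e *\<^sub>R w) * R < 1" using e R by simp
    then obtain x' where x': "g x' = g x + e *\<^sub>R w" by (rule gradient_perturb [OF R])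
    have pw: "(P x' K y)\<^sup>2 / 2 \<le> (P x K y)\<^sup>2 / 2 + e * (P x K y * (w \<bullet> (y - x)))
        + e\<^sup>2 * (indicator (cball x R') y * ((w \<bullet> (y - x))\<^sup>2 / 2))" (is "_ \<le> ?r") for y
    proof -
      define a where "a = K - D x y"
      define b where "b = a + e * (w \<bullet> (y - x))"
      \<comment> \<open>The constant term \<open>D x' x\<close> of the affine difference has a
        favourable sign and is dropped, so its size as a function of \<open>e\<close> never
        matters.\<close>
      have "K - D x' y \<le> b"
        using D_diff [of x y x'] D_nonneg [of x' x] by (simp add: x' a_def b_def)
      then have Pb: "(P x' K y)\<^sup>2 / 2 \<le> (max 0 b)\<^sup>2 / 2"
        unfolding P_def by (intro divide_right_mono power_mono) auto
      show ?thesis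
      proof (cases "y \<in> cball x R'")
        case True
        have "(max 0 b)\<^sup>2 / 2 \<le> (max 0 a)\<^sup>2 / 2 + max 0 a * (b - a) + (b - a)\<^sup>2 / 2"
          using trunc_sq_rem_le [of a b] by (simp add: trunc_sq_rem_def)
        also have "\<dots> = ?r"
          using True by (simp add: P_def a_def b_def power_mult_distrib mult.left_commute)
        finally show ?thesis using Pb by simp
      next
        case False
        then have n: "R < norm (y - x)" "2 * R * K < norm (y - x)"
          by (auto simp: R'_def dist_norm norm_minus_commute)
        have "norm (y - x) / R < D x y" using linear_growth [OF R, of y] n by simp
        moreover have "2 * K < norm (y - x) / R" using n R by (simp add: field_simps)
        moreover have "e * (w \<bullet> (y - x)) \<le> norm (y - x) / (2 * R)"
        proof -
          have "e * (w \<bullet> (y - x)) \<le> e * (norm w * norm (y - x))"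
            using e norm_cauchy_schwarz [of w "y - x"] by (intro mult_left_mono) auto
          also have "\<dots> = (e * norm w) * norm (y - x)" by simp
          also have "\<dots> \<le> 1 / (2 * R) * norm (y - x)"
            using ew R by (intro mult_right_mono) (auto simp: field_simps)
          finally show ?thesis by simp
        qed
        moreover have "norm (y - x) / (2 * R) = norm (y - x) / R / 2" by simp
        ultimately have "a < 0" "b < 0" using K by (auto simp: a_def b_def)
        then have "P x K y = 0" "max 0 b = 0" by (auto simp: P_def a_def)
        then show ?thesis using Pb by (simp add: indicator_def)
      qed
    qed
    have "(\<integral>y. (P x' K y)\<^sup>2 / 2 \<partial>lborel) \<le> (\<integral>y. (P x K y)\<^sup>2 / 2 + e * (P x K y * (w \<bullet> (y - x)))
        + e\<^sup>2 * (indicator (cball x R') y * ((w \<bullet> (y - x))\<^sup>2 / 2)) \<partial>lborel)"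
      by (intro integral_mono pw integrable_P_square Bochner_Integration.integrable_add
          integrable_mult_right intC intM)
    also have "\<dots> = (\<integral>y. (P x K y)\<^sup>2 / 2 \<partial>lborel) + e * ?c + e\<^sup>2 * C"
    proof -
      have "(\<integral>y. p y + e * q y + e\<^sup>2 * r y \<partial>lborel)
          = (\<integral>y. p y \<partial>lborel) + e * (\<integral>y. q y \<partial>lborel) + e\<^sup>2 * (\<integral>y. r y \<partial>lborel)"
        if "integrable lborel p" "integrable lborel q" "integrable lborel r" for p q r :: "'a \<Rightarrow> real"
        using that by simp
      from this [OF integrable_P_square intM intC] show ?thesis unfolding C_def .
    qed
    finally have "0 \<le> e * (?c + e * C)"
      using P_square_const [of x K x'] by (simp add: power2_eq_square algebra_simps)
    then show ?thesis using e by (simp add: zero_le_mult_iff)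
  qed
  have C: "0 \<le> C" unfolding C_def by (intro Bochner_Integration.integral_nonneg) simp
  show ?thesis
  proof (rule ccontr)
    assume "\<not> 0 \<le> ?c"
    then have c: "?c < 0" by simp
    \<comment> \<open>Chosen so that \<open>e * C\<close> is at most half of
      \<open>- ?c\<close>.\<close>
    define e where "e = min e0 (- ?c / (2 * (C + 1)))"
    have "0 < - ?c / (2 * (C + 1))" using c C by (intro divide_pos_pos) auto
    then have e: "0 < e" "e \<le> e0" using e0 by (auto simp: e_def)
    have "e * C \<le> (- ?c / (2 * (C + 1))) * (C + 1)"
      using C e by (intro mult_mono) (auto simp: e_def)
    also have "\<dots> = - ?c / 2" using C by (simp add: field_simps)
    finally show False using main [OF e] c by simp
  qed
qed

lemma moment_zero:
  assumes "0 < K" shows "(\<integral>y. P x K y * (w \<bullet> (y - x)) \<partial>lborel) = 0"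
proof -
  have "(\<integral>y. P x K y * ((- w) \<bullet> (y - x)) \<partial>lborel) = - (\<integral>y. P x K y * (w \<bullet> (y - x)) \<partial>lborel)"
    by simp
  then show ?thesis
    using moment_nonneg [OF assms, of x w] moment_nonneg [OF assms, of x "- w"] by linarith
qed

section \<open>Second-order comparison of two base points\<close>

lemma integrable_trunc_sq_rem: "integrable lborel (\<lambda>y. trunc_sq_rem (K - D x y) (K - D x' y))"
proof -
  have "integrable lborel (\<lambda>y. (P x' K y)\<^sup>2 / 2 - (P x K y)\<^sup>2 / 2 - P x K y * (D x y - D x' y))"
    by (intro Bochner_Integration.integrable_diff integrable_P_square integrable_P_mult continuous_intros)
  then show ?thesis by (simp add: trunc_sq_rem_def P_def)
qed

text \<open>The two square terms cancel by \<open>P_square_const\<close>. In the first-order term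
  the difference \<open>D x - D x'\<close> is affine: its linear part integrates to 0 by the
  centroid property, and its constant part \<open>- D x' x\<close> is what remains.\<close>

lemma integral_trunc_sq_rem:
  assumes K: "0 < K"
  shows "(\<integral>y. trunc_sq_rem (K - D x y) (K - D x' y) \<partial>lborel) = phi x K * D x' x"
proof -
  have i: "integrable lborel (\<lambda>y. P x K y * (D x y - D x' y))"
    by (intro integrable_P_mult continuous_intros)
  have i2: "integrable lborel (\<lambda>y. P x K y * ((g x' - g x) \<bullet> (y - x)))"
    by (intro integrable_P_mult continuous_intros)
  have "(\<integral>y. trunc_sq_rem (K - D x y) (K - D x' y) \<partial>lborel)
      = (\<integral>y. (P x' K y)\<^sup>2 / 2 - (P x K y)\<^sup>2 / 2 - P x K y * (D x y - D x' y) \<partial>lborel)"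
    by (simp add: trunc_sq_rem_def P_def)
  also have "\<dots> = - (\<integral>y. P x K y * (D x y - D x' y) \<partial>lborel)"
    using integrable_P_square [of x K] integrable_P_square [of x' K] i P_square_const [of x K x']
    by simp
  also have "(\<integral>y. P x K y * (D x y - D x' y) \<partial>lborel)
      = (\<integral>y. P x K y * ((g x' - g x) \<bullet> (y - x)) - P x K y * D x' x \<partial>lborel)"
    by (simp add: D_diff [of x _ x'] right_diff_distrib)
  also have "\<dots> = - phi x K * D x' x"
    using integrable_P [of x K] i2 moment_zero [OF K, of x "g x' - g x"] by (simp add: phi_def)
  finally show ?thesis by simp
qed

end

context constant_cap_volume
begin

text \<open>If the maximum \<open>\<omega>\<close> of \<open>\<bar>D x - D x'\<bar>\<close> on \<open>S x K\<close> is large, then by convexity the difference is at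
  least \<open>\<omega> / 4\<close> on a fixed proportion of \<open>S x (K / 2)\<close>, against the bound \<open>phi x K * D x' x\<close>.\<close>
lemma affine_growth:
  obtains C where "0 \<le> C" "\<And>K y. 1 \<le> K \<Longrightarrow> y \<in> S x K \<Longrightarrow> \<bar>D x y - D x' y\<bar> \<le> C * sqrt K"
proof -
  define \<delta> where "\<delta> y = D x y - D x' y" for y
  define d where "d = D x' x"
  \<comment> \<open>\<open>16 ^ n\<close> is \<open>2 ^ n * 8 ^ n\<close>: halving the height in
    \<open>psi_scale\<close>, and shrinking by 1/8 to form \<open>A\<close>. The summands of
    \<open>C\<close> answer the three cases below: \<open>\<omega> \<le> 7 * d\<close>, then the
    quadratic and the linear branch of \<open>trunc_sq_rem_ge\<close>.\<close>
  define N where "N = 16 ^ DIM('a) * d"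
  define C where "C = 7 * d + 4 * sqrt (2 * N) + 16 * N"
  have d: "0 \<le> d" unfolding d_def by (rule D_nonneg)
  then have N: "0 \<le> N" by (simp add: N_def)
  have C: "7 * d \<le> C" "4 * sqrt (2 * N) \<le> C" "16 * N \<le> C" "0 \<le> C"
    using d N by (auto simp: C_def)
  have \<delta>: "\<delta> ((1 - t) *\<^sub>R y + t *\<^sub>R z) = (1 - t) * \<delta> y + t * \<delta> z" for t y z
    unfolding \<delta>_def D_diff by (simp add: inner_simps algebra_simps)
  have \<delta>x: "\<delta> x = - d" by (simp add: \<delta>_def d_def)
  have cont: "continuous_on A \<delta>" for A unfolding \<delta>_def by (intro continuous_intros)
  have main: "\<bar>\<delta> y\<bar> \<le> C * sqrt K" if K: "1 \<le> K" and y: "y \<in> S x K" for K y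
  proof -
    have sK: "1 \<le> sqrt K" using K by simp
    have "continuous_on (S x K) (\<lambda>y. \<bar>\<delta> y\<bar>)" by (intro continuous_intros cont)
    then obtain y0 where y0: "y0 \<in> S x K" "\<And>y. y \<in> S x K \<Longrightarrow> \<bar>\<delta> y\<bar> \<le> \<bar>\<delta> y0\<bar>"
      using continuous_attains_sup [OF compact_S, of x K "\<lambda>y. \<bar>\<delta> y\<bar>"] y by auto
    define \<omega> where "\<omega> = \<bar>\<delta> y0\<bar>"
    define r where "r = \<omega> / 4"
    have "\<omega> \<le> C * sqrt K"
    proof (cases "\<omega> \<le> 7 * d")
      case True
      then have "\<omega> \<le> C * 1" using C by simp
      also have "\<dots> \<le> C * sqrt K" using C sK by (intro mult_left_mono)
      finally show ?thesis .
    next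
      case False
      have r: "0 \<le> r" by (simp add: r_def \<omega>_def)
      \<comment> \<open>The midpoint of \<open>x\<close> and the extremal point: convexity puts it
        in \<open>S x (K / 2)\<close>, and the affine \<open>\<delta>\<close> keeps about half of
        its maximum there.\<close>
      define m where "m = (1 - 1/2) *\<^sub>R x + (1/2) *\<^sub>R y0"
      have m: "m \<in> S x (K / 2)"
        using D_scale [of "1/2" x y0] y0 by (simp add: S_def m_def)
      have \<delta>m: "\<omega> / 2 - d / 2 \<le> \<bar>\<delta> m\<bar>"
        unfolding m_def \<delta> \<delta>x using d by (simp add: \<omega>_def)
      \<comment> \<open>Shrinking towards \<open>m\<close> keeps \<open>\<delta>\<close> near
        \<open>\<delta> m\<close>: on \<open>A\<close> its absolute value is at least
        \<open>7/8 * (\<omega> / 2 - d / 2) - \<omega> / 8\<close>, which reaches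
        \<open>\<omega> / 4\<close> as soon as \<open>\<omega> \<ge> 7 * d\<close>.\<close>
      define A where "A = (\<lambda>z. (1/8) *\<^sub>R z + (7/8) *\<^sub>R m) ` S x (K / 2)"
      have cA: "compact A"
        unfolding A_def by (intro compact_continuous_image continuous_intros compact_S)
      have A: "A \<subseteq> S x (K / 2)"
        using convexD [OF convex_S, of _ x "K / 2" m "1/8" "7/8"] m by (auto simp: A_def)
      have Ar: "r \<le> \<bar>\<delta> z\<bar>" if "z \<in> A" for z
      proof -
        obtain w where w: "w \<in> S x (K / 2)" "z = (1 - 1/8) *\<^sub>R m + (1/8) *\<^sub>R w"
          using \<open>z \<in> A\<close> by (auto simp: A_def add.commute)
        have "\<bar>\<delta> w\<bar> \<le> \<omega>"
          unfolding \<omega>_def using w S_mono [of "K / 2" K x] K by (intro y0) auto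
        moreover have "\<delta> z = 7/8 * \<delta> m + 1/8 * \<delta> w" unfolding w \<delta> by simp
        ultimately show ?thesis using \<delta>m False unfolding r_def by linarith
      qed
      have intA: "integrable lborel (indicator A :: 'a \<Rightarrow> real)"
        using fmeasurable_compact [OF cA] by (auto simp: fmeasurable_def integrable_indicator_iff)
      define \<mu> where "\<mu> = min (r\<^sup>2 / 2) (K * r / 4)"
      have "(\<integral>y. \<mu> * indicator A y \<partial>lborel)
          \<le> (\<integral>y. trunc_sq_rem (K - D x y) (K - D x' y) \<partial>lborel)"
      proof (intro integral_mono integrable_trunc_sq_rem integrable_mult_right intA)
        fix z
        show "\<mu> * indicator A z \<le> trunc_sq_rem (K - D x z) (K - D x' z)"
        proof (cases "z \<in> A")
          case True
          then have "K / 2 \<le> K - D x z" using A K by (auto simp: S_def)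
          moreover have "r \<le> \<bar>(K - D x' z) - (K - D x z)\<bar>"
            using Ar [OF True] by (simp add: \<delta>_def)
          ultimately have "\<mu> \<le> trunc_sq_rem (K - D x z) (K - D x' z)"
            unfolding \<mu>_def using K r by (intro trunc_sq_rem_ge) auto
          then show ?thesis using True by simp
        qed (simp add: trunc_sq_rem_nonneg)
      qed
      also have "\<dots> = phi x K * d"
        using K by (simp add: integral_trunc_sq_rem d_def)
      also have "\<dots> \<le> K * psi x K * d"
        using phi_upper [of K x] K d by (intro mult_right_mono) auto
      also have "psi x K \<le> 2 ^ DIM('a) * psi x (K / 2)"
        using psi_scale [of "1/2" x K] by (simp add: power_divide field_simps)
      then have "K * psi x K * d \<le> K * (2 ^ DIM('a) * psi x (K / 2)) * d"
        using K d by (intro mult_right_mono mult_left_mono) auto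
      finally have "\<mu> * measure lborel A \<le> K * (2 ^ DIM('a) * psi x (K / 2)) * d" by simp
      also have "measure lborel A = (1/8) ^ DIM('a) * psi x (K / 2)"
        using measure_lborel_affine_image [OF compact_S, of "1/8" "(7/8) *\<^sub>R m" x "K / 2"]
        by (simp add: A_def psi_def)
      finally have "\<mu> * (1/8) ^ DIM('a) * psi x (K / 2) \<le> K * d * 2 ^ DIM('a) * psi x (K / 2)"
        by (simp add: algebra_simps)
      then have "\<mu> * (1/8) ^ DIM('a) \<le> K * d * 2 ^ DIM('a)"
        using psi_pos [of "K / 2" x] K by simp
      then have "\<mu> \<le> K * d * 2 ^ DIM('a) * 8 ^ DIM('a)"
        by (simp add: power_divide pos_divide_le_eq)
      then have \<mu>: "\<mu> \<le> K * N"
        by (simp add: N_def algebra_simps flip: power_mult_distrib)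
      show ?thesis
      proof (cases "r\<^sup>2 / 2 \<le> K * r / 4")
        case True
        then have "r\<^sup>2 \<le> 2 * N * K" using \<mu> by (simp add: \<mu>_def mult.commute)
        then have "sqrt (r\<^sup>2) \<le> sqrt (2 * N * K)" by (rule real_sqrt_le_mono)
        then have "r \<le> sqrt (2 * N) * sqrt K" using r by (simp add: real_sqrt_mult)
        then have "\<omega> \<le> 4 * sqrt (2 * N) * sqrt K" by (simp add: r_def)
        also have "\<dots> \<le> C * sqrt K" using C sK by (intro mult_right_mono) auto
        finally show ?thesis .
      next
        case False
        then have "K * r / 4 \<le> K * N" using \<mu> by (simp add: \<mu>_def)
        then have "\<omega> \<le> 16 * N * 1" using K by (simp add: r_def)
        also have "\<dots> \<le> C * sqrt K" using C sK N by (intro mult_mono) auto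
        finally show ?thesis .
      qed
    qed
    then show ?thesis using y0(2) [OF y] by (simp add: \<omega>_def)
  qed
  show ?thesis using main by (intro that [OF C(4)]) (auto simp: \<delta>_def)
qed

text \<open>Exchanging \<open>x\<close> and \<open>x'\<close> in
  \<open>integral_trunc_sq_rem\<close> gives a difference of integrals equal to phi times
  \<open>D x' x - D x x'\<close>. The integrands differ only over the symmetric difference of the
  two sublevel sets, by O(K), and that set has measure O(phi / K^(3/2)).\<close>

lemma symmetric_D: "D x' x = D x x'"
proof (rule ccontr)
  assume ne: "D x' x \<noteq> D x x'"
  define \<epsilon> where "\<epsilon> = \<bar>D x' x - D x x'\<bar>"
  have \<epsilon>: "0 < \<epsilon>" using ne by (simp add: \<epsilon>_def)
  define n where "n = DIM('a)"
  obtain C1 where C1: "0 \<le> C1" "\<And>K y. 1 \<le> K \<Longrightarrow> y \<in> S x K \<Longrightarrow> \<bar>D x y - D x' y\<bar> \<le> C1 * sqrt K"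
    using affine_growth [of x x'] by blast
  obtain C2 where C2: "0 \<le> C2" "\<And>K y. 1 \<le> K \<Longrightarrow> y \<in> S x' K \<Longrightarrow> \<bar>D x' y - D x y\<bar> \<le> C2 * sqrt K"
    using affine_growth [of x' x] by blast
  define C where "C = max C1 C2"
  have C: "0 \<le> C" using C1 by (simp add: C_def)
  have bd: "\<bar>D x y - D x' y\<bar> \<le> C * sqrt K" if "1 \<le> K" "y \<in> S x K \<union> S x' K" for K y
  proof -
    have "\<bar>D x y - D x' y\<bar> \<le> C1 * sqrt K \<or> \<bar>D x y - D x' y\<bar> \<le> C2 * sqrt K"
      using C1 C2 that by (auto simp: abs_minus_commute)
    moreover have "C1 * sqrt K \<le> C * sqrt K" "C2 * sqrt K \<le> C * sqrt K"
      using that by (auto simp: C_def intro!: mult_right_mono)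
    ultimately show ?thesis by linarith
  qed
  \<comment> \<open>The square root of the height. The summands 1 and \<open>C\<close> give
    \<open>K \<ge> 1\<close> and a nonnegative ratio \<open>1 - C / s\<close>; the last one brings
    the final error \<open>C ^ 3 * n * 2 ^ n / s\<close> below \<open>\<epsilon>\<close>.\<close>
  define s where "s = 1 + C + C ^ 3 * n * 2 ^ n / \<epsilon>"
  define K where "K = s\<^sup>2"
  have s: "1 \<le> s" "C \<le> s" "C ^ 3 * n * 2 ^ n < s * \<epsilon>"
  proof -
    have nn: "0 \<le> C ^ 3 * n * 2 ^ n / \<epsilon>" using C \<epsilon> by simp
    then show "1 \<le> s" "C \<le> s" using C by (auto simp: s_def)
    have "s * \<epsilon> = (1 + C) * \<epsilon> + C ^ 3 * n * 2 ^ n"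
      using \<epsilon> by (simp add: s_def field_simps)
    moreover have "0 < (1 + C) * \<epsilon>" using C \<epsilon> by simp
    ultimately show "C ^ 3 * n * 2 ^ n < s * \<epsilon>" by linarith
  qed
  have K: "1 \<le> K" "sqrt K = s" "0 < K" using s by (auto simp: K_def)
  text \<open>The part of \<open>S u K\<close> outside \<open>S v K\<close> lies in a shell of relative thickness \<open>C / s\<close>.\<close>
  have shell: "measure lborel (S u K - S v K) \<le> n * C / s * (2 ^ (n + 1) * phi x K / K)"
    if uv: "\<And>y. y \<in> S u K \<Longrightarrow> \<bar>D u y - D v y\<bar> \<le> C * s" for u v
  proof -
    define t where "t = 1 - C / s"
    have t: "0 \<le> t" "t \<le> 1" using s C by (auto simp: t_def)
    have tK: "t * K = K - C * s"
      using s by (simp add: t_def K_def power2_eq_square field_simps)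
    have sub: "S u (t * K) \<subseteq> S u K" using t K by (intro S_mono) (simp add: mult_left_le_one_le)
    have "S u K - S v K \<subseteq> S u K - S u (t * K)"
    proof
      fix y assume y: "y \<in> S u K - S v K"
      then have "\<bar>D u y - D v y\<bar> \<le> C * s" "K < D v y" using uv [of y] by (auto simp: S_def)
      then have "K - C * s < D u y" by (simp add: abs_le_iff)
      then show "y \<in> S u K - S u (t * K)" using y by (simp add: S_def tK)
    qed
    then have "measure lborel (S u K - S v K) \<le> measure lborel (S u K - S u (t * K))"
      by (intro measure_mono_fmeasurable fmeasurable.Diff fmeasurable_compact compact_S) auto
    also have "\<dots> = psi u K - psi u (t * K)"
      unfolding psi_def using sub by (intro measurable_measure_Diff fmeasurable_compact compact_S) auto
    also have "\<dots> \<le> psi u K - t ^ n * psi u K"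
      using psi_scale [OF t, of u K] by (simp add: n_def)
    also have "\<dots> \<le> n * C / s * psi u K"
    proof -
      have "1 + real n * (- (C / s)) \<le> (1 + - (C / s)) ^ n"
        using s by (intro Bernoulli_inequality) (simp add: field_simps)
      then have "(1 - t ^ n) * psi u K \<le> (n * C / s) * psi u K"
        using psi_pos [OF K(3), of u] by (intro mult_right_mono) (auto simp: t_def)
      then show ?thesis by (simp add: left_diff_distrib)
    qed
    also have "\<dots> \<le> n * C / s * (2 ^ (n + 1) * phi x K / K)"
    proof (intro mult_left_mono)
      \<comment> \<open>Constancy of the cap volume lets both shells be measured against the same
        \<open>phi x K\<close>.\<close>
      have "K * psi u K \<le> 2 ^ (n + 1) * phi x K"
        using phi_lower [OF K(3), of u] phi_const [OF K(3), of u x] by (simp add: n_def)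
      then show "psi u K \<le> 2 ^ (n + 1) * phi x K / K" using K by (simp add: field_simps)
    qed (use s C in auto)
    finally show ?thesis .
  qed
  define Q where "Q y = trunc_sq_rem (K - D x y) (K - D x' y) - trunc_sq_rem (K - D x' y) (K - D x y)" for y
  define c where "c = (C * s)\<^sup>2 / 4"
  have ind: "integrable lborel (indicator (S u K - S v K) :: 'a \<Rightarrow> real)" for u v
    using fmeasurable.Diff [OF fmeasurable_compact [OF compact_S [of u K]] fmeasurable_compact [OF compact_S [of v K]]]
    by (auto simp: fmeasurable_def integrable_indicator_iff)
  have intQ: "integrable lborel Q"
    unfolding Q_def by (intro Bochner_Integration.integrable_diff integrable_trunc_sq_rem)
  have "(\<integral>y. Q y \<partial>lborel) = phi x K * D x' x - phi x' K * D x x'"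
    unfolding Q_def using K by (simp add: integrable_trunc_sq_rem integral_trunc_sq_rem)
  then have "phi x K * \<epsilon> = \<bar>\<integral>y. Q y \<partial>lborel\<bar>"
    using phi_const [OF K(3), of x' x] phi_pos [OF K(3), of x]
    by (simp add: \<epsilon>_def abs_mult flip: right_diff_distrib)
  also have "\<dots> \<le> (\<integral>y. \<bar>Q y\<bar> \<partial>lborel)" by (rule integral_abs_bound)
  also have "\<dots> \<le> (\<integral>y. c * indicator (S x K - S x' K) y + c * indicator (S x' K - S x K) y \<partial>lborel)"
  proof (intro integral_mono integrable_abs intQ Bochner_Integration.integrable_add integrable_mult_right ind)
    fix y
    have q: "\<bar>Q y\<bar> \<le> (if 0 \<le> K - D x y \<longleftrightarrow> 0 \<le> K - D x' y then 0 else (D x y - D x' y)\<^sup>2 / 4)"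
      unfolding Q_def using trunc_sq_rem_diff [of "K - D x y" "K - D x' y"] by (simp cong: if_cong)
    show "\<bar>Q y\<bar> \<le> c * indicator (S x K - S x' K) y + c * indicator (S x' K - S x K) y"
    proof (cases "y \<in> S x K \<longleftrightarrow> y \<in> S x' K")
      case True
      then have "\<bar>Q y\<bar> \<le> 0" using q by (simp add: S_def split: if_splits)
      then show ?thesis by (simp add: c_def)
    next
      case False
      then have "\<bar>D x y - D x' y\<bar> \<le> C * s" using bd [OF K(1), of y] K by auto
      then have "(D x y - D x' y)\<^sup>2 \<le> (C * s)\<^sup>2"
        by (metis abs_ge_zero power2_abs power_mono)
      then have "\<bar>Q y\<bar> \<le> c" using q False by (simp add: S_def c_def split: if_splits)
      then show ?thesis using False by (auto simp: indicator_def)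
    qed
  qed
  also have "\<dots> = c * measure lborel (S x K - S x' K) + c * measure lborel (S x' K - S x K)"
    by (simp add: ind)
  also have "\<dots> \<le> c * (n * C / s * (2 ^ (n + 1) * phi x K / K)) + c * (n * C / s * (2 ^ (n + 1) * phi x K / K))"
  proof (intro add_mono mult_left_mono shell)
    show "\<bar>D x y - D x' y\<bar> \<le> C * s" if "y \<in> S x K" for y
      using bd [OF K(1), of y] that K by simp
    show "\<bar>D x' y - D x y\<bar> \<le> C * s" if "y \<in> S x' K" for y
      using bd [OF K(1), of y] that K by (simp add: abs_minus_commute)
  qed (auto simp: c_def)
  also have "\<dots> = phi x K * (C ^ 3 * n * 2 ^ n / s)"
    using s by (simp add: c_def K_def power2_eq_square power3_eq_cube field_simps)
  finally have "\<epsilon> \<le> C ^ 3 * n * 2 ^ n / s"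
    using phi_pos [OF K(3)] by (rule mult_left_le_imp_le)
  then show False using s by (simp add: pos_le_divide_eq mult.commute)
qed

text \<open>Symmetry of \<open>D\<close> between \<open>x\<close> and 0 already expresses
  \<open>f\<close> through its gradient; symmetry between \<open>u\<close> and \<open>v\<close> then
  says that \<open>A\<close> is self-adjoint.\<close>

lemma quadratic:
  obtains A where "linear A" "\<And>u v. A u \<bullet> v = u \<bullet> A v" "\<And>v. v \<noteq> 0 \<Longrightarrow> 0 < A v \<bullet> v"
    "\<And>x. f x = f 0 + g 0 \<bullet> x + (A x \<bullet> x) / 2"
proof -
  define A where "A v = g v - g 0" for v
  have f: "f x = f 0 + g 0 \<bullet> x + (A x \<bullet> x) / 2" for x
    using symmetric_D [of x 0] by (simp add: D_def A_def inner_simps field_simps)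
  have sym: "A u \<bullet> v = u \<bullet> A v" for u v
  proof -
    have g: "g u = A u + g 0" "g v = A v + g 0" by (simp_all add: A_def)
    show ?thesis
      using symmetric_D [of u v] unfolding D_def f [of u] f [of v] g
      by (simp add: inner_simps inner_commute field_simps)
  qed
  \<comment> \<open>A self-adjoint map is automatically linear: paired with any \<open>z\<close>,
    the defect moves onto \<open>A z\<close>, where it vanishes.\<close>
  have lin: "linear A"
  proof (rule linearI)
    fix u v
    have "(A (u + v) - (A u + A v)) \<bullet> z = 0" for z
      by (simp add: inner_simps sym)
    from this [of "A (u + v) - (A u + A v)"] show "A (u + v) = A u + A v" by simp
  next
    fix t u
    have "(A (t *\<^sub>R u) - t *\<^sub>R A u) \<bullet> z = 0" for z
      by (simp add: inner_simps sym)
    from this [of "A (t *\<^sub>R u) - t *\<^sub>R A u"] show "A (t *\<^sub>R u) = t *\<^sub>R A u" by simp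
  qed
  have D0: "D 0 v = (A v \<bullet> v) / 2" for v by (simp add: D_def f [of v])
  \<comment> \<open>Otherwise \<open>D 0\<close> would vanish along the whole line through
    \<open>v\<close>, against compactness of \<open>S 0 1\<close>.\<close>
  have pos: "0 < A v \<bullet> v" if v: "v \<noteq> 0" for v
  proof (rule ccontr)
    assume "\<not> 0 < A v \<bullet> v"
    then have z: "A v \<bullet> v = 0" using D_nonneg [of 0 v] by (simp add: D0)
    have "t *\<^sub>R v \<in> S 0 1" for t
      by (simp add: S_def D0 linear_cmul [OF lin] z)
    moreover obtain B where "\<And>y. y \<in> S 0 1 \<Longrightarrow> norm y \<le> B"
      using compact_imp_bounded [OF compact_S [of 0 1]] unfolding bounded_iff by blast
    ultimately have B: "\<bar>t\<bar> * norm v \<le> B" for t by (metis norm_scaleR)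
    from B [of 0] B [of "(B + 1) / norm v"] v show False by simp
  qed
  show ?thesis by (rule that [OF lin sym pos f])
qed

end

section \<open>Quadratic forms and paraboloids\<close>

text \<open>A maximiser of the Rayleigh quotient on the unit sphere of \<open>V\<close> is an
  eigenvector, and its orthogonal complement in \<open>V\<close> is again invariant. Stating the
  result for invariant subspaces makes induction on the dimension possible.\<close>

lemma self_adjoint_eigenbasis:
  fixes A :: "'a::euclidean_space \<Rightarrow> 'a"
  assumes lin: "linear A" and sym: "\<And>u v. A u \<bullet> v = u \<bullet> A v"
    and V: "subspace V" "A ` V \<subseteq> V"
  shows "\<exists>B. B \<subseteq> V \<and> pairwise orthogonal B \<and> (\<forall>b\<in>B. norm b = 1 \<and> (\<exists>c. A b = c *\<^sub>R b)) \<and> V \<subseteq> span B"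
  using V
proof (induction "dim V" arbitrary: V rule: less_induct)
  case less
  show ?case
  proof (cases "V \<subseteq> {0}")
    case True
    then show ?thesis by (intro exI [of _ "{}"]) auto
  next
    case False
    then obtain v0 where v0: "v0 \<in> V" "v0 \<noteq> 0" by auto
    have cont: "continuous_on X A" for X
      using lin by (simp add: linear_continuous_on linear_conv_bounded_linear)
    have "compact (V \<inter> sphere 0 1)"
      using less.prems by (intro closed_Int_compact closed_subspace) auto
    moreover have "v0 /\<^sub>R norm v0 \<in> V \<inter> sphere 0 1"
      using v0 less.prems by (auto intro: subspace_scale)
    moreover have "continuous_on (V \<inter> sphere 0 1) (\<lambda>v. A v \<bullet> v)"
      by (intro continuous_intros cont)
    ultimately obtain b where "b \<in> V \<inter> sphere 0 1"
      and "\<forall>v\<in>V \<inter> sphere 0 1. A v \<bullet> v \<le> A b \<bullet> b"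
      using continuous_attains_sup [of "V \<inter> sphere 0 1" "\<lambda>v. A v \<bullet> v"] by blast
    then have b: "b \<in> V" "norm b = 1"
      and max: "\<And>v. v \<in> V \<Longrightarrow> norm v = 1 \<Longrightarrow> A v \<bullet> v \<le> A b \<bullet> b" by auto
    define c where "c = A b \<bullet> b"
    have bb: "b \<bullet> b = 1" using b by (simp add: norm_eq_1)
    have max': "A v \<bullet> v \<le> c * (v \<bullet> v)" if "v \<in> V" for v
    proof (cases "v = 0")
      case False
      then have "A (v /\<^sub>R norm v) \<bullet> (v /\<^sub>R norm v) \<le> c"
        unfolding c_def using that less.prems by (intro max) (auto intro: subspace_scale)
      then have "(A v \<bullet> v) / (norm v * norm v) \<le> c"
        by (simp add: linear_cmul [OF lin] divide_inverse mult_ac)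
      then show ?thesis
        using False by (simp add: pos_divide_le_eq power2_norm_eq_inner flip: power2_eq_square)
    qed (simp add: linear_0 [OF lin])
    define w where "w = A b - c *\<^sub>R b"
    have wV: "w \<in> V"
      using b less.prems unfolding w_def by (intro subspace_diff subspace_scale) auto
    have wb: "w \<bullet> b = 0" by (simp add: w_def c_def inner_simps bb)
    have "A b \<bullet> w = w \<bullet> w"
      using wb by (simp add: w_def inner_simps inner_commute)
    \<comment> \<open>Maximality of \<open>b\<close> tested at \<open>b + t *\<^sub>R w\<close>. The
      first-order gain can be dominated by a term of order \<open>t * t\<close> for small
      \<open>t\<close> only if the residual \<open>w\<close> is 0.\<close>
    then have quad: "2 * t * (w \<bullet> w) \<le> t * t * (c * (w \<bullet> w) - A w \<bullet> w)" for t
    proof -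
      assume Abw: "A b \<bullet> w = w \<bullet> w"
      have "b + t *\<^sub>R w \<in> V" using b wV less.prems by (intro subspace_add subspace_scale) auto
      from max' [OF this]
      have "A b \<bullet> b + t * (A b \<bullet> w) + (t * (A w \<bullet> b) + t * t * (A w \<bullet> w)) \<le> c * (b \<bullet> b + t * t * (w \<bullet> w))"
        using wb by (simp add: linear_add [OF lin] linear_cmul [OF lin] inner_simps inner_commute algebra_simps)
      moreover have "A w \<bullet> b = w \<bullet> w" using Abw sym [of b w] by (simp add: inner_commute)
      ultimately show ?thesis using Abw bb by (simp add: c_def [symmetric] algebra_simps)
    qed
    have "w \<bullet> w = 0"
    proof (rule ccontr)
      assume ne: "w \<bullet> w \<noteq> 0"
      then have p: "0 < w \<bullet> w" using inner_ge_zero [of w] by linarith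
      define k where "k = c * (w \<bullet> w) - A w \<bullet> w"
      define t where "t = (w \<bullet> w) / (\<bar>k\<bar> + 1)"
      have t: "0 < t" using p by (simp add: t_def)
      have "t * (2 * (w \<bullet> w)) \<le> t * (t * k)" using quad [of t] by (simp add: k_def mult_ac)
      then have "2 * (w \<bullet> w) \<le> t * k" using t by simp
      also have "\<dots> \<le> t * (\<bar>k\<bar> + 1)" using t by (intro mult_left_mono) auto
      also have "\<dots> = w \<bullet> w" by (simp add: t_def)
      finally show False using p by simp
    qed
    then have Ab: "A b = c *\<^sub>R b" by (simp add: w_def)
    define W where "W = {v \<in> V. v \<bullet> b = 0}"
    have W: "subspace W"
      using less.prems by (auto simp: W_def subspace_def inner_simps)
    have AW: "A ` W \<subseteq> W"
      using less.prems by (auto simp: W_def sym Ab)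
    have "b \<notin> W" "W \<subseteq> V" using bb by (auto simp: W_def)
    then have "W \<subset> V" using b by blast
    then have "dim W < dim V"
      using W less.prems by (metis dim_psubset span_eq_iff)
    from less.hyps [OF this W AW] obtain B where B: "B \<subseteq> W" "pairwise orthogonal B"
      "\<forall>b\<in>B. norm b = 1 \<and> (\<exists>c. A b = c *\<^sub>R b)" "W \<subseteq> span B" by blast
    have "pairwise orthogonal (insert b B)"
      using B by (auto simp: pairwise_insert W_def orthogonal_def inner_commute)
    moreover have "V \<subseteq> span (insert b B)"
    proof
      fix v assume v: "v \<in> V"
      have "v - (v \<bullet> b) *\<^sub>R b \<in> W"
        using v b bb less.prems by (auto simp: W_def inner_simps intro: subspace_diff subspace_scale)
      then have "v - (v \<bullet> b) *\<^sub>R b \<in> span B" using B by blast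
      then show "v \<in> span (insert b B)" by (auto simp: span_insert)
    qed
    ultimately show ?thesis
      using B b Ab by (intro exI [of _ "insert b B"]) (auto simp: W_def)
  qed
qed

lemma self_adjoint_diagonalize:
  fixes A :: "real^'n \<Rightarrow> real^'n"
  assumes lin: "linear A" and sym: "\<And>u v. A u \<bullet> v = u \<bullet> A v"
  obtains L :: "real^'n \<Rightarrow> real^'n" and c where "orthogonal_transformation L" "\<And>x. A (L x) \<bullet> L x = (\<Sum>i\<in>UNIV. c i * (x $ i)\<^sup>2)"
    "\<And>i. A (L (axis i 1)) = c i *\<^sub>R L (axis i 1)"
proof -
  obtain B where B: "pairwise orthogonal B" "\<And>b. b \<in> B \<Longrightarrow> norm b = 1"
      "\<And>b. b \<in> B \<Longrightarrow> \<exists>c. A b = c *\<^sub>R b" "span B = UNIV"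
  proof -
    from self_adjoint_eigenbasis [OF lin sym subspace_UNIV subset_UNIV]
    obtain B where "pairwise orthogonal B" "\<forall>b\<in>B. norm b = 1 \<and> (\<exists>c. A b = c *\<^sub>R b)" "UNIV \<subseteq> span B"
      by blast
    then show ?thesis by (intro that [of B]) auto
  qed
  have ind: "independent B"
    using B(1,2) by (intro pairwise_orthogonal_independent) force+
  then have card: "card B = CARD('n)"
    using dim_span_eq_card_independent [OF ind] by (simp add: B(4))
  have "finite B" using ind independent_imp_finite by blast
  then obtain \<beta> :: "'n \<Rightarrow> real^'n" where \<beta>: "bij_betw \<beta> UNIV B"
    using card finite_same_card_bij [of "UNIV :: 'n set" B] by auto
  have \<beta>B: "\<beta> i \<in> B" for i using \<beta> by (auto simp: bij_betw_def)
  have on: "\<beta> i \<bullet> \<beta> j = (if i = j then 1 else 0)" for i j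
  proof (cases "i = j")
    case True then show ?thesis using B(2) [OF \<beta>B [of i]] by (simp add: norm_eq_1)
  next
    case False
    then have "\<beta> i \<noteq> \<beta> j" using \<beta> by (auto simp: bij_betw_def inj_on_def)
    then show ?thesis using False B(1) \<beta>B by (auto simp: pairwise_def orthogonal_def)
  qed
  have "\<forall>i. \<exists>c. A (\<beta> i) = c *\<^sub>R \<beta> i" using B(3) \<beta>B by blast
  from choice [OF this] obtain c where c: "\<And>i. A (\<beta> i) = c i *\<^sub>R \<beta> i" by blast
  define L where "L x = (\<Sum>i\<in>UNIV. (x $ i) *\<^sub>R \<beta> i)" for x :: "real^'n"
  have linL: "linear L"
    by (rule linearI) (simp_all add: L_def scaleR_left_distrib sum.distrib scaleR_sum_right)
  have dot: "(\<Sum>i\<in>UNIV. a i *\<^sub>R \<beta> i) \<bullet> (\<Sum>i\<in>UNIV. b i *\<^sub>R \<beta> i) = (\<Sum>i\<in>UNIV. a i * b i)" for a b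
    by (simp add: inner_sum_left inner_sum_right on if_distrib [of "(*) _"] mult.commute cong: if_cong)
  have "orthogonal_transformation L"
  proof -
    have "L v \<bullet> L w = v \<bullet> w" for v w
      unfolding L_def dot by (simp add: inner_vec_def)
    with linL show ?thesis by (simp add: orthogonal_transformation_def)
  qed
  moreover have "A (L x) = (\<Sum>i\<in>UNIV. (c i * x $ i) *\<^sub>R \<beta> i)" for x
    by (simp add: L_def linear_sum [OF lin] linear_cmul [OF lin] c mult.commute)
  then have "A (L x) \<bullet> L x = (\<Sum>i\<in>UNIV. c i * (x $ i)\<^sup>2)" for x
    by (simp add: L_def dot power2_eq_square mult.assoc)
  moreover have "L (axis i 1) = \<beta> i" for i
    by (simp add: L_def axis_def if_distrib [of "\<lambda>t. t *\<^sub>R _"] cong: if_cong)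
  ultimately show ?thesis using c by (intro that) auto
qed

text \<open>Completing the square: the rigid motion carries the origin to the vertex and the
  coordinate axes to eigenvectors of \<open>A\<close>.\<close>

lemma elliptic_paraboloid_quadratic:
  fixes f :: "real^'n \<Rightarrow> real"
  assumes lin: "linear A" and sym: "\<And>u v. A u \<bullet> v = u \<bullet> A v"
    and pos: "\<And>v. v \<noteq> 0 \<Longrightarrow> 0 < A v \<bullet> v"
    and f: "\<And>x. f x = f 0 + p \<bullet> x + (A x \<bullet> x) / 2"
  shows "elliptic_paraboloid (graph_of f)"
proof -
  have "inj A"
  proof (rule linear_injective_0 [THEN iffD2, OF lin], intro allI impI)
    fix v assume "A v = 0" then show "v = 0" using pos [of v] by auto
  qed
  then have "surj A" by (rule linear_inj_imp_surj [OF lin])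
  \<comment> \<open>The critical point of \<open>f\<close>, over which the vertex lies.\<close>
  then obtain z where z: "A z = - p" by (metis surjD)
  have fz: "f (z + v) = f z + (A v \<bullet> v) / 2" for v
    unfolding f [of "z + v"] f [of z]
    using sym [of v z] by (simp add: linear_add [OF lin] inner_simps z inner_commute field_simps)
  obtain L :: "real^'n \<Rightarrow> real^'n" and c where L: "orthogonal_transformation L"
    and Lc: "\<And>x. A (L x) \<bullet> L x = (\<Sum>i\<in>UNIV. c i * (x $ i)\<^sup>2)"
    and ev: "\<And>i. A (L (axis i 1)) = c i *\<^sub>R L (axis i 1)"
    using self_adjoint_diagonalize [OF lin sym] by blast
  have c: "0 < c i" for i
  proof -
    have n: "norm (L (axis i 1)) = 1" by (simp add: orthogonal_transformation_norm [OF L])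
    then have "0 < A (L (axis i 1)) \<bullet> L (axis i 1)" by (intro pos) auto
    then show ?thesis using n by (simp add: ev norm_eq_1)
  qed
  define a :: "real^'n" where "a = (\<chi> i. sqrt (c i / 2))"
  have a: "0 < a $ i" "(a $ i)\<^sup>2 = c i / 2" for i using c [of i] by (auto simp: a_def)
  define T where "T u = (z + L (fst u), f z + snd u)" for u :: "(real^'n) \<times> real"
  have surjL: "surj L" by (rule orthogonal_transformation_surj [OF L])
  have "rigid_motion T"
    unfolding rigid_motion_def
  proof (intro conjI allI)
    show "surj T"
    proof (rule surjI)
      fix u :: "(real^'n) \<times> real"
      show "T (inv L (fst u - z), snd u - f z) = u"
        by (simp add: T_def surj_f_inv_f [OF surjL])
    qed
    show "dist (T u) (T v) = dist u v" for u v
      using L by (cases u, cases v) (simp add: T_def dist_Pair_Pair orthogonal_transformation_isometry dist_add_cancel)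
  qed
  moreover have "graph_of f = T ` {(x, \<Sum>i\<in>UNIV. (a $ i)\<^sup>2 * (x $ i)\<^sup>2) | x. True}"
  proof -
    have eq: "T (x, \<Sum>i\<in>UNIV. (a $ i)\<^sup>2 * (x $ i)\<^sup>2) = (z + L x, f (z + L x))" for x
      by (simp add: T_def fz Lc a sum_divide_distrib)
    have "T ` {(x, \<Sum>i\<in>UNIV. (a $ i)\<^sup>2 * (x $ i)\<^sup>2) | x. True} = {(z + L x, f (z + L x)) | x. True}"
      using eq by (auto simp: image_iff) 
    also have "\<dots> = graph_of f"
      unfolding graph_of_def
    proof (intro subset_antisym subsetI)
      fix u assume "u \<in> {(x, f x) |x. True}"
      then obtain x where "u = (x, f x)" by blast
      then have "u = (z + L (inv L (x - z)), f (z + L (inv L (x - z))))"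
        by (simp add: surj_f_inv_f [OF surjL])
      then show "u \<in> {(z + L x, f (z + L x)) |x. True}" by blast
    qed blast
    finally show ?thesis by simp
  qed
  ultimately show ?thesis unfolding elliptic_paraboloid_def using a by blast
qed

text \<open>The inverse motion sends the vertical direction to a unit vector \<open>e\<close>. Being
  a graph over the whole space forces \<open>e\<close> to be parallel to the axis, and convexity
  decides its sign. The horizontal part is then linear, and the scaling \<open>B0\<close> turns the
  quadratic form into a squared norm.\<close>

lemma convex_elliptic_paraboloid_graph:
  fixes f :: "real^'n \<Rightarrow> real"
  assumes par: "elliptic_paraboloid (graph_of f)" and conv: "convex_on UNIV f"
  obtains B :: "real^'n \<Rightarrow> real^'n" and b s where "linear B" "inj B" "\<And>y. f y = (norm (B y + b))\<^sup>2 - s"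
proof -
  obtain T :: "(real^'n) \<times> real \<Rightarrow> _" and a :: "real^'n" where T: "surj T" "\<And>u v. dist (T u) (T v) = dist u v"
    and a: "\<And>i. a $ i > 0"
    and M: "graph_of f = T ` {(x, \<Sum>i\<in>UNIV. (a $ i)\<^sup>2 * (x $ i)\<^sup>2) | x. True}"
    using par unfolding elliptic_paraboloid_def rigid_motion_def by blast
  have "inj T" by (rule injI) (metis T(2) dist_eq_0_iff)
  define U where "U = inv T"
  have TU: "T (U z) = z" "U (T z) = z" for z
    using T(1) \<open>inj T\<close> by (simp_all add: U_def surj_f_inv_f)
  define L where "L z = U z - U 0" for z
  have "norm (U u - U v) = norm (u - v)" for u v
    using T(2) [of "U u" "U v"] by (simp add: TU dist_norm)
  then have "orthogonal_transformation L"
    unfolding orthogonal_transformation_isometry by (simp add: L_def dist_norm)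
  then have L: "linear L" "\<And>u v. L u \<bullet> L v = u \<bullet> v"
    by (auto simp: orthogonal_transformation_def)
  have U: "U z = U 0 + L z" for z by (simp add: L_def)
  define B0 where "B0 x = (\<chi> i. a $ i * x $ i)" for x :: "real^'n"
  have linB0: "linear B0" by (rule linearI) (simp_all add: B0_def vec_eq_iff algebra_simps)
  have B0_0: "B0 x = 0 \<longleftrightarrow> x = 0" for x
    using a by (auto simp: B0_def vec_eq_iff less_le)
  have nB0: "(norm (B0 x))\<^sup>2 = (\<Sum>i\<in>UNIV. (a $ i)\<^sup>2 * (x $ i)\<^sup>2)" for x
    unfolding power2_norm_eq_inner by (simp add: inner_vec_def B0_def power2_eq_square algebra_simps)
  define q where "q z = (norm (B0 (fst z)))\<^sup>2 - snd z" for z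
  have mem: "q (U (y, t)) = 0 \<longleftrightarrow> t = f y" for y t
  proof -
    have "t = f y \<longleftrightarrow> (y, t) \<in> graph_of f" by (auto simp: graph_of_def)
    also have "\<dots> \<longleftrightarrow> U (y, t) \<in> {(x, \<Sum>i\<in>UNIV. (a $ i)\<^sup>2 * (x $ i)\<^sup>2) | x. True}"
      unfolding M using TU(2) by (subst TU(1) [of "(y, t)", symmetric]) (rule inj_image_mem_iff [OF \<open>inj T\<close>])
    also have "\<dots> \<longleftrightarrow> q (U (y, t)) = 0"
      by (cases "U (y, t)") (auto simp: q_def nB0)
    finally show ?thesis by simp
  qed
  define e where "e = L (0, 1)"
  have Uyt: "U (y, t + s) = U (y, t) + s *\<^sub>R e" for y t s
  proof -
    have "L (y, t + s) = L (y, t) + L (s *\<^sub>R (0, 1))"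
      by (simp flip: linear_add [OF L(1)])
    then show ?thesis
      unfolding U [of "(y, t + s)"] U [of "(y, t)"] e_def by (simp only: linear_cmul [OF L(1)] add.assoc)
  qed
  text \<open>If the vertical direction were not mapped to the axis, every vertical line would touch the
    paraboloid, and no point would lie above it.\<close>
  have e0: "fst e = 0"
  proof (rule ccontr)
    assume ne: "fst e \<noteq> 0"
    define \<alpha> where "\<alpha> = B0 (fst e) \<bullet> B0 (fst e)"
    have \<alpha>: "0 < \<alpha>" using ne B0_0 by (simp add: \<alpha>_def)
    have qpos: "0 \<le> q (U (y, t))" for y t
    proof -
      define X where "X = U (y, f y)"
      define \<beta> where "\<beta> = 2 * (B0 (fst X) \<bullet> B0 (fst e)) - snd e"
      have "q X = 0" using mem [of y "f y"] by (simp add: X_def)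
      then have qs: "q (U (y, f y + s)) = s * \<beta> + s * s * \<alpha>" for s
        unfolding Uyt X_def [symmetric] q_def \<beta>_def \<alpha>_def
        by (simp add: linear_add [OF linB0] linear_cmul [OF linB0] power2_norm_eq_inner inner_simps inner_commute algebra_simps)
      \<comment> \<open>A vertical line meets the graph once, so the second root of this quadratic
        in \<open>s\<close> must coincide with the root 0.\<close>
      have "q (U (y, f y + (- \<beta> / \<alpha>))) = 0"
        unfolding qs using \<alpha> by (simp add: field_simps)
      then have "\<beta> = 0" using \<alpha> by (simp add: mem)
      then show ?thesis using qs [of "t - f y"] \<alpha> by simp
    qed
    have "q (U (T (0, 1))) = - 1" unfolding TU q_def by (simp add: linear_0 [OF linB0])
    then show False using qpos [of "fst (T (0, 1))" "snd (T (0, 1))"] by simp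
  qed
  define \<sigma> where "\<sigma> = snd e"
  have e: "e = (0, \<sigma>)" using e0 by (simp add: \<sigma>_def prod_eq_iff)
  have "e \<bullet> e = 1" by (simp add: e_def L(2) inner_Pair)
  then have \<sigma>: "\<sigma> = 1 \<or> \<sigma> = - 1" by (simp add: e inner_Pair square_eq_1_iff)
  define R where "R y = fst (L (y, 0))" for y
  have Ly: "L (y, 0) = (R y, 0)" for y
  proof -
    have "L (y, 0) \<bullet> e = 0" by (simp add: e_def L(2) inner_Pair)
    then show ?thesis using \<sigma> by (cases "L (y, 0)") (auto simp: e R_def inner_Pair)
  qed
  have linR: "linear R"
  proof (rule linearI)
    fix y z have "L (y + z, 0) = L (y, 0) + L (z, 0)"
      using linear_add [OF L(1), of "(y, 0)" "(z, 0)"] by simp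
    then show "R (y + z) = R y + R z" by (simp add: R_def)
  next
    fix t y have "L (t *\<^sub>R y, 0) = t *\<^sub>R L (y, 0)"
      using linear_cmul [OF L(1), of t "(y, 0)"] by simp
    then show "R (t *\<^sub>R y) = t *\<^sub>R R y" by (simp add: R_def)
  qed
  have R0: "R y = 0 \<Longrightarrow> y = 0" for y
    using L(2) [of "(y, 0)" "(y, 0)"] by (simp add: Ly inner_Pair)
  define B where "B y = B0 (R y)" for y
  have linB: "linear B" unfolding B_def using linear_compose [OF linR linB0] by (simp add: o_def)
  have B0': "B y = 0 \<Longrightarrow> y = 0" for y using B0_0 R0 by (simp add: B_def)
  then have injB: "inj B" using linear_injective_0 [OF linB] by blast
  define b where "b = B0 (fst (U 0))"
  have eq: "\<sigma> * f y = (norm (B y + b))\<^sup>2 - snd (U 0)" for y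
  proof -
    have "U (y, f y) = U 0 + (R y, \<sigma> * f y)"
      using Uyt [of y 0 "f y"] U [of "(y, 0)"] by (simp add: e Ly)
    then have "q (U 0 + (R y, \<sigma> * f y)) = 0" using mem [of y "f y"] by simp
    then show ?thesis by (simp add: q_def B_def b_def linear_add [OF linB0] add.commute)
  qed
  have "\<sigma> = 1"
  proof (rule ccontr)
    assume "\<sigma> \<noteq> 1"
    then have f: "f y = snd (U 0) - (norm (B y + b))\<^sup>2" for y using \<sigma> eq [of y] by auto
    \<comment> \<open>Any nonzero vector serves; \<open>undefined\<close> is just some coordinate
      index. Convexity fails at the midpoint of \<open>v\<close> and \<open>- v\<close>.\<close>
    define v :: "real^'n" where "v = axis undefined 1"
    have v: "B v \<noteq> 0" using B0' [of v] by (auto simp: v_def)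
    have "f ((1 - 1/2) *\<^sub>R v + (1/2) *\<^sub>R (- v)) \<le> (1 - 1/2) * f v + (1/2) * f (- v)"
      using conv by (intro convex_onD) auto
    then have "B v \<bullet> B v \<le> 0"
      unfolding f by (simp add: linear_0 [OF linB] linear_neg [OF linB] power2_norm_eq_inner inner_simps inner_commute field_simps)
    then show False using v inner_gt_zero_iff [of "B v"] by linarith
  qed
  then have "f y = (norm (B y + b))\<^sup>2 - snd (U 0)" for y using eq [of y] by simp
  then show ?thesis by (rule that [OF linB injB])
qed

section \<open>Area and volume of the caps of a graph\<close>

text \<open>The square root of the first fundamental form of the graph of \<open>y \<mapsto> p \<bullet> y\<close>: a rotation taking \<open>p\<close>
  to a coordinate axis, followed by a stretch along this axis.\<close>
lemma graph_metric_sqrt: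
  fixes p :: "real^'n"
  obtains G H :: "real^'n \<Rightarrow> real^'n" where
    "linear G" "linear H" "\<And>v. H (G v) = v" "\<And>v. G (H v) = v"
    "\<And>v. (norm (G v))\<^sup>2 = (norm v)\<^sup>2 + (p \<bullet> v)\<^sup>2"
    "\<And>A. A \<in> sets borel \<Longrightarrow>
       emeasure lborel {z. H z \<in> A} = ennreal (sqrt (1 + (norm p)\<^sup>2)) * emeasure lborel A"
proof -
  define W where "W = sqrt (1 + (norm p)\<^sup>2)"
  have W: "0 < W" "W\<^sup>2 = 1 + (norm p)\<^sup>2" by (auto simp: W_def add_pos_nonneg)
  define e :: "real^'n" where "e = axis undefined 1"
  have e: "e \<in> Basis" "e \<bullet> e = 1" "norm (norm p *\<^sub>R e) = norm p"
    by (auto simp: e_def inner_axis_axis axis_in_Basis_iff)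
  obtain R where R: "orthogonal_transformation R" "R p = norm p *\<^sub>R e"
    using orthogonal_transformation_exists [of p "norm p *\<^sub>R e"] e(3) by metis
  define R' where "R' = inv R"
  have R': "orthogonal_transformation R'" "\<And>v. R (R' v) = v" "\<And>v. R' (R v) = v"
    using orthogonal_transformation_inv [OF R(1)] orthogonal_transformation_bij [OF R(1)]
    by (auto simp: R'_def bij_is_surj surj_f_inv_f bij_is_inj)
  note linR = orthogonal_transformation_linear [OF R(1)] and linR' = orthogonal_transformation_linear [OF R'(1)]
  define E where "E t v = v + ((t - 1) * (v \<bullet> e)) *\<^sub>R e" for t and v :: "real^'n"
  have linE: "linear (E t)" for t
    by (rule linearI) (simp_all add: E_def inner_simps algebra_simps)
  have EE: "E s (E t v) = v" if "s * t = 1" for s t v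
  proof -
    have "E t v \<bullet> e = t * (v \<bullet> e)" using e by (simp add: E_def inner_simps algebra_simps)
    then have "E s (E t v) = v + ((t - 1) + (s - 1) * t) *\<^sub>R ((v \<bullet> e) *\<^sub>R e)"
      unfolding E_def [of s] by (simp add: E_def algebra_simps)
    also have "(t - 1) + (s - 1) * t = 0" using that by (simp add: algebra_simps)
    finally show ?thesis by simp
  qed
  define G where "G v = E W (R v)" for v
  define H where "H v = R' (E (1 / W) v)" for v
  have "linear G" "linear H"
    using linear_compose [OF linR linE [of W]] linear_compose [OF linE [of "1 / W"] linR']
    by (simp_all add: G_def [abs_def] H_def [abs_def] o_def)
  moreover have "H (G v) = v" "G (H v) = v" for v
    using W by (simp_all add: G_def H_def EE R')
  moreover have "(norm (G v))\<^sup>2 = (norm v)\<^sup>2 + (p \<bullet> v)\<^sup>2" for v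
  proof -
    have "(norm (E W u))\<^sup>2 = (norm u)\<^sup>2 + (W\<^sup>2 - 1) * (u \<bullet> e)\<^sup>2" for u
      using e unfolding E_def power2_norm_eq_inner
      by (simp add: inner_simps inner_commute power2_eq_square algebra_simps)
    moreover have "p \<bullet> v = norm p * (R v \<bullet> e)"
    proof -
      have "p \<bullet> v = R p \<bullet> R v" using R(1) by (simp add: orthogonal_transformation_def)
      then show ?thesis by (simp add: R(2) inner_commute)
    qed
    ultimately show ?thesis
      using W orthogonal_transformation_norm [OF R(1)] by (simp add: G_def power_mult_distrib)
  qed
  moreover have "emeasure lborel {z. H z \<in> A} = ennreal W * emeasure lborel A"
    if A: "A \<in> sets borel" for A
  proof -
    define c where "c j = (if j = e then 1 / W else 1)" for j
    have E: "(\<lambda>v. 0 + (\<Sum>j\<in>Basis. (c j * (v \<bullet> j)) *\<^sub>R j)) = E (1 / W)"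
    proof
      fix v
      have "(\<Sum>j\<in>Basis. (c j * (v \<bullet> j)) *\<^sub>R j)
          = (\<Sum>j\<in>Basis. (v \<bullet> j) *\<^sub>R j + (if j = e then ((1 / W - 1) * (v \<bullet> e)) *\<^sub>R e else 0))"
        by (intro sum.cong) (auto simp: c_def algebra_simps)
      also have "\<dots> = E (1 / W) v"
        using e by (simp add: sum.distrib euclidean_representation E_def)
      finally show "0 + (\<Sum>j\<in>Basis. (c j * (v \<bullet> j)) *\<^sub>R j) = E (1 / W) v" by simp
    qed
    have cW: "(\<Prod>j\<in>Basis. \<bar>c j\<bar>) = 1 / W"
    proof -
      have "(\<Prod>j\<in>Basis. \<bar>c j\<bar>) = (\<Prod>j\<in>Basis. if j = e then 1 / W else 1)"
        using W by (intro prod.cong) (auto simp: c_def)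
      then show ?thesis using e by simp
    qed
    have "c j \<noteq> 0" for j using W by (simp add: c_def)
    then have lb: "lborel = density (distr lborel borel (E (1 / W))) (\<lambda>_. ennreal (1 / W))"
      using lborel_affine_euclidean [of c 0] unfolding E cW by blast
    have [measurable]: "E (1 / W) \<in> borel_measurable borel" "R' \<in> borel_measurable borel"
      using linE linR' by (auto intro!: borel_measurable_continuous_onI linear_continuous_on simp: linear_conv_bounded_linear)
    define B where "B = {z. R' z \<in> A}"
    have B: "B \<in> sets borel" using measurable_sets_borel [of R' borel A] A by (simp add: B_def vimage_def)
    have "emeasure lborel B = ennreal (1 / W) * emeasure lborel {z. E (1 / W) z \<in> B}"
      using B by (subst lb) (simp add: emeasure_density_const emeasure_distr vimage_def)
    also have "emeasure lborel B = emeasure lborel A"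
      unfolding B_def by (rule emeasure_lborel_vimage_orthogonal [OF R'(1) A])
    also have "{z. E (1 / W) z \<in> B} = {z. H z \<in> A}" by (simp add: B_def H_def)
    finally have "ennreal W * emeasure lborel A = (ennreal W * ennreal (1 / W)) * emeasure lborel {z. H z \<in> A}"
      by (simp add: mult.assoc)
    also have "ennreal W * ennreal (1 / W) = 1"
      using W by (simp flip: ennreal_mult)
    finally show ?thesis by simp
  qed
  ultimately show ?thesis unfolding W_def by (rule that)
qed

text \<open>The parametrisation in \<open>hyperplane_area\<close> is an unknown choice. Comparing it
  with the explicit isometry built from \<open>H\<close> leaves an orthogonal map and a translation,
  and both preserve Lebesgue measure.\<close>

lemma hyperplane_area_graph:
  fixes p :: "real^'n"
  assumes A: "A \<in> sets borel"
  shows "hyperplane_area {(y, c + p \<bullet> y) | y. True} {(y, c + p \<bullet> y) | y. y \<in> A}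
      = ennreal (sqrt (1 + (norm p)\<^sup>2)) * emeasure lborel A"
proof -
  let ?P = "{(y, c + p \<bullet> y) | y. True}"
  let ?isom = "\<lambda>T :: real^'n \<Rightarrow> (real^'n) \<times> real. range T = ?P \<and> (\<forall>u v. dist (T u) (T v) = dist u v)"
  obtain G H :: "real^'n \<Rightarrow> real^'n" where lin: "linear G" "linear H" and HG: "\<And>v. H (G v) = v" "\<And>v. G (H v) = v"
    and nG: "\<And>v. (norm (G v))\<^sup>2 = (norm v)\<^sup>2 + (p \<bullet> v)\<^sup>2"
    and mH: "\<And>A. A \<in> sets borel \<Longrightarrow>
       emeasure lborel {z. H z \<in> A} = ennreal (sqrt (1 + (norm p)\<^sup>2)) * emeasure lborel A"
    by (rule graph_metric_sqrt [of p]) blast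
  have dG: "dist (y, c + p \<bullet> y) (z, c + p \<bullet> z) = dist (G y) (G z)" for y z
  proof -
    have "(dist (y, c + p \<bullet> y) (z, c + p \<bullet> z))\<^sup>2 = (norm (y - z))\<^sup>2 + (p \<bullet> (y - z))\<^sup>2"
      by (simp only: dist_Pair_Pair) (simp add: dist_norm inner_diff_right)
    also have "\<dots> = (dist (G y) (G z))\<^sup>2"
      by (simp add: nG [symmetric] dist_norm linear_diff [OF lin(1)])
    finally show ?thesis by (simp add: power2_eq_iff_nonneg)
  qed
  \<comment> \<open>An explicit witness, so that the choice operator really yields an isometric
    parametrisation.\<close>
  have "?isom (\<lambda>u. (H u, c + p \<bullet> H u))"
  proof (intro conjI allI)
    show "range (\<lambda>u. (H u, c + p \<bullet> H u)) = ?P"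
    proof (intro subset_antisym subsetI)
      fix z assume "z \<in> ?P"
      then obtain y where "z = (H (G y), c + p \<bullet> H (G y))" by (auto simp: HG)
      then show "z \<in> range (\<lambda>u. (H u, c + p \<bullet> H u))" by blast
    qed auto
    show "dist (H u, c + p \<bullet> H u) (H v, c + p \<bullet> H v) = dist u v" for u v
      by (simp add: dG HG)
  qed
  then have "?isom (SOME T. ?isom T)" by (rule someI [where P = ?isom])
  then obtain T where T: "T = (SOME T. ?isom T)" "?isom T" by blast
  have Teq: "T u = (fst (T u), c + p \<bullet> fst (T u))" for u
  proof -
    have "T u \<in> ?P" using T(2) by blast
    then show ?thesis by auto
  qed
  \<comment> \<open>The chosen parametrisation read in the isometric coordinates \<open>G\<close>
    and normalised to fix 0; a distance-preserving map fixing 0 is orthogonal.\<close>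
  define Q where "Q u = G (fst (T u)) - G (fst (T 0))" for u
  have "dist (Q u) (Q v) = dist u v" for u v
  proof -
    have "dist (Q u) (Q v) = dist (G (fst (T u))) (G (fst (T v)))"
      by (simp add: Q_def dist_norm)
    also have "\<dots> = dist (T u) (T v)" 
      using dG [of "fst (T u)" "fst (T v)"] by (simp only: Teq [symmetric])
    finally show ?thesis using T(2) by simp
  qed
  then have Q: "orthogonal_transformation Q"
    unfolding orthogonal_transformation_isometry by (simp add: Q_def)
  define a where "a = G (fst (T 0))"
  define B where "B = {z. H z \<in> A}"
  have mv: "{z. h z \<in> X} \<in> sets borel" if "continuous_on UNIV h" "X \<in> sets borel" for h :: "real^'n \<Rightarrow> real^'n" and X
    using measurable_sets_borel [OF borel_measurable_continuous_onI [OF that(1)], of X] that(2)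
    by (simp add: vimage_def)
  have B: "B \<in> sets borel"
    unfolding B_def using lin(2) A by (intro mv linear_continuous_on) (simp_all add: linear_conv_bounded_linear)
  have C: "{z. a + z \<in> B} \<in> sets borel" using B by (intro mv continuous_intros)
  have "{u. T u \<in> {(y, c + p \<bullet> y) | y. y \<in> A}} = {u. Q u \<in> {z. a + z \<in> B}}"
  proof -
    have "T u \<in> {(y, c + p \<bullet> y) | y. y \<in> A} \<longleftrightarrow> Q u \<in> {z. a + z \<in> B}" for u
      by (subst Teq) (auto simp: Q_def a_def B_def HG)
    then show ?thesis by blast
  qed
  moreover have "emeasure lebesgue {u. Q u \<in> {z. a + z \<in> B}} = emeasure lborel {u. Q u \<in> {z. a + z \<in> B}}"
  proof -
    have "continuous_on UNIV Q"
      using orthogonal_transformation_linear [OF Q] by (simp add: linear_continuous_on linear_conv_bounded_linear)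
    then show ?thesis using mv [OF _ C] by simp
  qed
  moreover have "\<dots> = emeasure lborel {z. a + z \<in> B}"
    by (rule emeasure_lborel_vimage_orthogonal [OF Q C])
  moreover have "\<dots> = emeasure lborel B"
  proof -
    have "emeasure lborel B = emeasure (distr lborel borel ((+) a)) B" by (simp add: lborel_distr_plus)
    also have "\<dots> = emeasure lborel {z. a + z \<in> B}"
      using B by (simp add: emeasure_distr vimage_def)
    finally show ?thesis by simp
  qed
  ultimately have "emeasure lebesgue {u. T u \<in> {(y, c + p \<bullet> y) | y. y \<in> A}}
      = ennreal (sqrt (1 + (norm p)\<^sup>2)) * emeasure lborel A"
    using mH [OF A] by (simp add: B_def)
  then show ?thesis unfolding hyperplane_area_def Let_def T(1) by simp
qed

section \<open>Translation between the geometry of the graph and the Bregman divergence\<close>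

lemma frechet_derivative_gradient:
  fixes f :: "real^'n \<Rightarrow> real"
  assumes "f differentiable (at x)"
  shows "frechet_derivative f (at x) h = gradient f x \<bullet> h"
proof -
  have lin: "linear (frechet_derivative f (at x))"
    using assms by (rule linear_frechet_derivative)
  have "h = (\<Sum>i\<in>UNIV. h $ i *\<^sub>R axis i 1)"
    by (simp add: vec_eq_iff axis_def if_distrib [of "(*) _"] cong: if_cong)
  then have "frechet_derivative f (at x) h = frechet_derivative f (at x) (\<Sum>i\<in>UNIV. h $ i *\<^sub>R axis i 1)"
    by (rule arg_cong)
  also have "\<dots> = gradient f x \<bullet> h"
    by (simp add: linear_sum [OF lin] linear_cmul [OF lin] gradient_def inner_vec_def mult.commute)
  finally show ?thesis .
qed

lemma convex_potential_gradient:
  fixes f :: "real^'n \<Rightarrow> real"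
  assumes "f differentiable_on UNIV" "convex_on UNIV f"
  shows "convex_potential f (gradient f)"
proof
  fix x
  have d: "f differentiable (at x)" using assms(1) by (simp add: differentiable_on_def)
  have "frechet_derivative f (at x) = (\<lambda>h. gradient f x \<bullet> h)"
    using frechet_derivative_gradient [OF d] by auto
  then show "(f has_derivative (\<lambda>h. gradient f x \<bullet> h)) (at x)"
    using d [unfolded frechet_derivative_works] by simp
qed (rule assms)

text \<open>For such an \<open>f\<close> the divergence depends on \<open>y - x\<close> only, so
  caps of equal height project to translates of each other.\<close>

lemma (in convex_potential) quadratic_D:
  fixes B :: "'a \<Rightarrow> 'a"
  assumes lin: "linear B" and f: "\<And>y. f y = (norm (B y + b))\<^sup>2 - s"
  shows "D x y = (norm (B (y - x)))\<^sup>2"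
proof -
  have fx: "f (x + h) = f x + 2 * ((B x + b) \<bullet> B h) + (norm (B h))\<^sup>2" for h
    unfolding f by (simp add: linear_add [OF lin] power2_norm_eq_inner inner_simps inner_commute algebra_simps)
  have g: "g x \<bullet> h = 2 * ((B x + b) \<bullet> B h)" for h
  proof -
    have B: "(B has_derivative B) (at x)"
      using lin by (simp add: bounded_linear_imp_has_derivative linear_conv_bounded_linear)
    have "((\<lambda>y. (B y + b) \<bullet> (B y + b) - s) has_derivative (\<lambda>h. (B x + b) \<bullet> B h + B h \<bullet> (B x + b))) (at x)"
      by (auto intro!: derivative_eq_intros B)
    also have "(\<lambda>y. (B y + b) \<bullet> (B y + b) - s) = f"
      by (simp add: f power2_norm_eq_inner fun_eq_iff)
    also have "(\<lambda>h. (B x + b) \<bullet> B h + B h \<bullet> (B x + b)) = (\<lambda>h. 2 * ((B x + b) \<bullet> B h))"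
      by (simp add: inner_commute fun_eq_iff)
    finally have "(f has_derivative (\<lambda>h. 2 * ((B x + b) \<bullet> B h))) (at x)" .
    from has_derivative_unique [OF deriv_f this] show ?thesis by (rule fun_cong)
  qed
  show ?thesis using fx [of "y - x"] by (simp add: D_def g)
qed

context
  fixes f :: "real^'n \<Rightarrow> real"
  assumes diff: "f differentiable_on UNIV" and conv: "convex_on UNIV f"
begin

interpretation convex_potential f "gradient f"
  using diff conv by (rule convex_potential_gradient)

lemma frechet_gradient: "frechet_derivative f (at x) h = gradient f x \<bullet> h"
  using diff by (intro frechet_derivative_gradient) (simp add: differentiable_on_def)

text \<open>Fubini along vertical lines. \<open>ennreal\<close> sends negative numbers to 0, which
  matches the empty chords.\<close>

lemma V_star_eq: "V_star f x k = (\<integral>\<^sup>+y. ennreal (k - D x y) \<partial>lborel)"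
proof -
  let ?u = "\<lambda>y. f x + k + gradient f x \<bullet> (y - x)"
  have V: "V_region f x k = {z. f (fst z) \<le> snd z} \<inter> {z. snd z \<le> ?u (fst z)}"
    by (auto simp: V_region_def frechet_gradient)
  have "continuous_on UNIV (\<lambda>z :: (real^'n) \<times> real. f (fst z))"
    by (rule continuous_on_compose2 [OF continuous_f]) (auto intro: continuous_intros)
  then have "closed (V_region f x k)"
    unfolding V by (intro closed_Int closed_Collect_le continuous_intros)
  then have sets: "V_region f x k \<in> sets borel" by (rule borel_closed)
  then have "V_star f x k = emeasure (lborel \<Otimes>\<^sub>M lborel) (V_region f x k)"
    by (simp add: V_star_def emeasure_completion lborel_prod)
  also have "\<dots> = (\<integral>\<^sup>+y. emeasure lborel (Pair y -` V_region f x k) \<partial>lborel)"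
    using sets by (intro lborel.emeasure_pair_measure_alt) (simp only: lborel_prod sets_lborel)
  also have "\<dots> = (\<integral>\<^sup>+y. ennreal (k - D x y) \<partial>lborel)"
  proof (intro nn_integral_cong)
    fix y
    have "Pair y -` V_region f x k = {f y..?u y}" by (auto simp: V)
    then show "emeasure lborel (Pair y -` V_region f x k) = ennreal (k - D x y)"
      by (cases "f y \<le> ?u y") (auto simp: D_def ennreal_neg algebra_simps)
  qed
  finally show ?thesis .
qed

text \<open>\<open>W\<close> is the factor by which vertical projection of the tangent hyperplane
  reduces area; dividing by it leaves the measure of the projected face.\<close>

lemma A_star_eq: "A_star f x k / ennreal (W_fun f x) = emeasure lborel (S x k)"
proof -
  define c where "c = f x + k - gradient f x \<bullet> x"
  have H: "shifted_hyperplane f x k = {(y, c + gradient f x \<bullet> y) | y. True}"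
  proof -
    have "tangent_hyperplane f x = range (\<lambda>y. (y, f x + gradient f x \<bullet> (y - x)))"
      by (auto simp: tangent_hyperplane_def frechet_gradient)
    then have "shifted_hyperplane f x k = range (\<lambda>y. (y, c + gradient f x \<bullet> y))"
      by (simp add: shifted_hyperplane_def image_image c_def inner_diff_right algebra_simps)
    then show ?thesis by auto
  qed
  have R: "A_region f x k = {(y, c + gradient f x \<bullet> y) | y. y \<in> S x k}"
    unfolding A_region_def H by (auto simp: S_def D_def c_def inner_diff_right)
  have "0 < W_fun f x" by (simp add: W_fun_def add_pos_nonneg)
  moreover have "A_star f x k = ennreal (W_fun f x) * emeasure lborel (S x k)"
    unfolding A_star_def R unfolding H W_fun_def by (rule hyperplane_area_graph) (rule sets_S)
  ultimately show ?thesis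
    by (simp add: mult.commute [of "ennreal (W_fun f x)"] ennreal_mult_divide_eq)
qed

lemma constant_volume_imp_paraboloid:
  assumes V: "\<And>x k. 0 < k \<Longrightarrow> V_star f x k = ennreal (\<phi> k)"
  shows "elliptic_paraboloid (graph_of f)"
proof -
  interpret constant_cap_volume f "gradient f"
    using V by unfold_locales (auto simp: V_star_eq)
  obtain A where "linear A" "\<And>u v. A u \<bullet> v = u \<bullet> A v" "\<And>v. v \<noteq> 0 \<Longrightarrow> 0 < A v \<bullet> v"
    "\<And>x. f x = f 0 + gradient f 0 \<bullet> x + (A x \<bullet> x) / 2"
    using quadratic by blast
  then show ?thesis by (rule elliptic_paraboloid_quadratic)
qed

lemma constant_area_imp_constant_volume:
  assumes A: "\<And>x k. 0 < k \<Longrightarrow> A_star f x k / ennreal (W_fun f x) = ennreal (\<psi> k)"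
  obtains \<phi> where "\<And>x k. 0 < k \<Longrightarrow> V_star f x k = ennreal (\<phi> k)"
proof -
  have S: "emeasure lborel (S x k) = ennreal (\<psi> k)" if "0 < k" for x k
    using A [OF that, of x] by (simp add: A_star_eq)
  have const: "V_star f x k = V_star f 0 k" for x k
    unfolding V_star_eq layer_cake
    by (intro nn_integral_cong) (simp add: S indicator_def)
  \<comment> \<open>The cap has thickness at most \<open>k\<close> over \<open>S 0 k\<close>, whose
    measure is the real number \<open>\<psi> k\<close>.\<close>
  have "V_star f 0 k < \<infinity>" if k: "0 < k" for k
  proof -
    have "V_star f 0 k \<le> (\<integral>\<^sup>+y. ennreal k * indicator (S 0 k) y \<partial>lborel)"
      unfolding V_star_eq using D_nonneg [of 0]
      by (intro nn_integral_mono) (auto simp: indicator_def S_def ennreal_neg intro!: ennreal_leI)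
    also have "\<dots> = ennreal k * ennreal (\<psi> k)" by (simp add: nn_integral_cmult S k)
    also have "\<dots> < \<infinity>" by (simp add: ennreal_mult_less_top)
    finally show ?thesis .
  qed
  then have "V_star f x k = ennreal (enn2real (V_star f 0 k))" if "0 < k" for x k
    using that const [of x k] by simp
  then show ?thesis by (rule that)
qed

lemma paraboloid_imp_constant:
  assumes "elliptic_paraboloid (graph_of f)"
  obtains \<phi> \<psi> :: "real \<Rightarrow> real" where "\<And>k. 0 \<le> \<phi> k" "\<And>k. 0 \<le> \<psi> k"
    "\<And>x k. V_star f x k = ennreal (\<phi> k)"
    "\<And>x k. A_star f x k / ennreal (W_fun f x) = ennreal (\<psi> k)"
proof -
  obtain B :: "real^'n \<Rightarrow> real^'n" and b s where B: "linear B" "inj B" "\<And>y. f y = (norm (B y + b))\<^sup>2 - s"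
    using convex_elliptic_paraboloid_graph [OF assms conv] by blast
  have D: "D x y = (norm (B (y - x)))\<^sup>2" for x y by (rule quadratic_D [OF B(1,3)])
  define a where "a k = emeasure lborel (S 0 k)" for k
  define v where "v k = (\<integral>\<^sup>+y. ennreal (k - D 0 y) \<partial>lborel)" for k
  have Dx: "D x (x + y) = D 0 y" for x y by (simp add: D)
  have Veq: "V_star f x k = v k" for x k
    using nn_integral_lborel_translate [of "\<lambda>y. ennreal (k - D x y)" x]
    by (simp add: V_star_eq v_def Dx)
  have Seq: "emeasure lborel (S x k) = a k" for x k
  proof -
    have "emeasure lborel (S x k) = (\<integral>\<^sup>+y. indicator (S x k) (x + y) \<partial>lborel)"
      using nn_integral_lborel_translate [of "indicator (S x k)" x] by simp
    also have "(\<lambda>y. indicator (S x k) (x + y) :: ennreal) = indicator (S 0 k)"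
      by (auto simp: S_def indicator_def Dx)
    finally show ?thesis by (simp add: a_def)
  qed
  \<comment> \<open>Injectivity bounds \<open>B\<close> from below, so the sublevel sets are bounded
    and both functions take real values.\<close>
  obtain m where m: "0 < m" "\<And>y. norm y * m \<le> norm (B y)"
    using linear_inj_bounded_below_pos [OF B(1,2)] by (metis mult.commute)
  have afin: "a k < \<infinity>" for k
  proof -
    have "S 0 k \<subseteq> cball 0 (sqrt \<bar>k\<bar> / m)"
    proof
      fix y assume "y \<in> S 0 k"
      then have "(norm (B y))\<^sup>2 \<le> \<bar>k\<bar>" by (simp add: S_def D)
      then have "norm (B y) \<le> sqrt \<bar>k\<bar>" by (rule real_le_rsqrt)
      then show "y \<in> cball 0 (sqrt \<bar>k\<bar> / m)"
        using m(1) m(2) [of y] by (simp add: pos_le_divide_eq)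
    qed
    then have "bounded (S 0 k)" by (rule bounded_subset [OF bounded_cball])
    then show ?thesis unfolding a_def using emeasure_bounded_finite by blast
  qed
  have vfin: "v k < \<infinity>" for k
  proof -
    have "v k \<le> (\<integral>\<^sup>+y. ennreal k * indicator (S 0 k) y \<partial>lborel)"
      unfolding v_def using D_nonneg
      by (intro nn_integral_mono) (auto simp: indicator_def S_def ennreal_neg intro!: ennreal_leI)
    also have "\<dots> = ennreal k * a k" by (simp add: a_def nn_integral_cmult)
    also have "\<dots> < \<infinity>" using afin by (simp add: ennreal_mult_less_top)
    finally show ?thesis .
  qed
  show ?thesis
  proof (rule that)
    show "0 \<le> enn2real (v k)" "0 \<le> enn2real (a k)" for k by simp_all
    show "V_star f x k = ennreal (enn2real (v k))" for x k
      using vfin [of k] by (simp add: Veq)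
    show "A_star f x k / ennreal (W_fun f x) = ennreal (enn2real (a k))" for x k
      using afin [of k] by (simp add: A_star_eq Seq)
  qed
qed

end

theorem theorem5:
  fixes f :: "real^'n \<Rightarrow> real"
  assumes "smooth_fun f" and "convex_on UNIV f"
  shows "(elliptic_paraboloid (graph_of f) \<longleftrightarrow>
            (\<exists>\<phi> :: real \<Rightarrow> real. (\<forall>k>0. 0 \<le> \<phi> k) \<and>
               (\<forall>x. \<forall>k>0. V_star f x k = ennreal (\<phi> k))))
       \<and> (elliptic_paraboloid (graph_of f) \<longleftrightarrow>
            (\<exists>\<psi> :: real \<Rightarrow> real. (\<forall>k>0. 0 \<le> \<psi> k) \<and>
               (\<forall>x. \<forall>k>0. A_star f x k / ennreal (W_fun f x) = ennreal (\<psi> k))))"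
proof -
  have diff: "f differentiable_on UNIV" using assms(1) unfolding smooth_fun_def by blast
  note d = diff assms(2)
  have V: "elliptic_paraboloid (graph_of f)"
    if "\<forall>x. \<forall>k>0. V_star f x k = ennreal (\<phi> k)" for \<phi> :: "real \<Rightarrow> real"
    using that by (intro constant_volume_imp_paraboloid [OF d]) blast
  have A: "elliptic_paraboloid (graph_of f)"
    if "\<forall>x. \<forall>k>0. A_star f x k / ennreal (W_fun f x) = ennreal (\<psi> k)" for \<psi> :: "real \<Rightarrow> real"
  proof -
    have "A_star f x k / ennreal (W_fun f x) = ennreal (\<psi> k)" if "0 < k" for x k
      using \<open>\<forall>x. \<forall>k>0. _\<close> that by blast
    from constant_area_imp_constant_volume [OF d this]
    obtain \<phi> where "\<And>x k. 0 < k \<Longrightarrow> V_star f x k = ennreal (\<phi> k)" by blast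
    then show ?thesis by (rule constant_volume_imp_paraboloid [OF d])
  qed
  show ?thesis
  proof (intro conjI iffI)
    assume "elliptic_paraboloid (graph_of f)"
    from paraboloid_imp_constant [OF d this]
    obtain \<phi> \<psi> :: "real \<Rightarrow> real" where "\<And>k. 0 \<le> \<phi> k" "\<And>k. 0 \<le> \<psi> k"
      "\<And>x k. V_star f x k = ennreal (\<phi> k)"
      "\<And>x k. A_star f x k / ennreal (W_fun f x) = ennreal (\<psi> k)" by blast
    then show "\<exists>\<phi> :: real \<Rightarrow> real. (\<forall>k>0. 0 \<le> \<phi> k) \<and>
               (\<forall>x. \<forall>k>0. V_star f x k = ennreal (\<phi> k))"
      and "\<exists>\<psi> :: real \<Rightarrow> real. (\<forall>k>0. 0 \<le> \<psi> k) \<and>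
               (\<forall>x. \<forall>k>0. A_star f x k / ennreal (W_fun f x) = ennreal (\<psi> k))" by blast+
  qed (use V A in blast)+
qed

end
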